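(* Let $\Omega\subset\mathbb{R}^N$ be a bounded regular domain. For every Lipschitz function $g:\partial\Omega\to\mathbb{R}$ there is a unique viscosity solution $u_\infty$ to $$\max\left\{-\Delta_\infty u_\infty,\ -|\nabla u_\infty|+\chi_{\{u_\infty>0\}}\right\}=0\ \text{ in }\Omega,\qquad u_\infty=g\ \text{ on }\partial\Omega.$$ Moreover, a comparison principle holds: if $g_1\le g_2$ on $\partial\Omega$ (with $g_1,g_2$ Lipschitz), then the corresponding solutions $u_\infty^1$ and $u_\infty^2$ satisfy $u_\infty^1\le u_\infty^2$ in $\Omega$.
   Context: $\Delta_\infty u=\nabla u^T D^2u\,\nabla u$; $\chi_A$ is the characteristic function of $A$. "Regular domain" means a domain with smooth boundary. Viscosity solutions of $\max\{-\Delta_\infty u,\chi_{\{u>0\}}-|\nabla u|\}=0$ in $\Omega$: an upper semicontinuous function $u:\Omega\to\mathbb{R}$ is a viscosity subsolution if, whenever $x_0\in\Omega$ and $\varphi\in C^2(\Omega)$ are such that $u-\varphi$ has a strict local maximum at $x_0$, then $\max\{-\Delta_\infty\varphi(x_0),\chi_{\{u>0\}}(x_0)-|\nabla\varphi(x_0)|\}\le0$. A lower semicontinuous $u$ is a viscosity supersolution if, whenever $u-\varphi$ has a strict local minimum at $x_0$, then $\max\{-\Delta_\infty\varphi(x_0),\chi_{\{u\ge0\}}(x_0)-|\nabla\varphi(x_0)|\}\ge0$. A viscosity solution is a continuous function that is both; the boundary condition means $u\in C(\overline\Omega)$ with $u=g$ on $\partial\Omega$. *)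

theory Defs
  imports "HOL-Analysis.Analysis"
begin

(* All derivatives are Frechet derivatives at (at x), so the following is meant for open S only. *)
primrec Ck_on ::
  "nat \<Rightarrow> 'a::real_normed_vector set \<Rightarrow> ('a \<Rightarrow> 'b::real_normed_vector) \<Rightarrow> bool" where
  "Ck_on 0 S f \<longleftrightarrow> continuous_on S f"
| "Ck_on (Suc k) S f \<longleftrightarrow>
     (\<forall>x\<in>S. f differentiable (at x)) \<and>
     (\<forall>v. Ck_on k S (\<lambda>x. frechet_derivative f (at x) v))"

definition smooth_on ::
  "'a::real_normed_vector set \<Rightarrow> ('a \<Rightarrow> 'b::real_normed_vector) \<Rightarrow> bool" where
  "smooth_on S f \<longleftrightarrow> (\<forall>k. Ck_on k S f)"

(* Near each boundary point, after a rotation of the axes taking e to the last axis, \<Omega> is the set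
   of points strictly above the graph of a smooth function \<gamma>. Only the values of \<gamma> on the
   hyperplane orthogonal to e are used; x - (x \<bullet> e) e is the projection of x to it. *)
definition smooth_boundary :: "(real^'n) set \<Rightarrow> bool" where
  "smooth_boundary \<Omega> \<longleftrightarrow>
     (\<forall>x0\<in>frontier \<Omega>. \<exists>r>0. \<exists>e. \<exists>\<gamma> :: real^'n \<Rightarrow> real.
        norm e = 1 \<and> smooth_on UNIV \<gamma> \<and>
        (\<forall>x\<in>ball x0 r. x \<in> \<Omega> \<longleftrightarrow> \<gamma> (x - (x \<bullet> e) *\<^sub>R e) < x \<bullet> e))"

definition regular_domain :: "(real^'n) set \<Rightarrow> bool" where
  "regular_domain \<Omega> \<longleftrightarrow> open \<Omega> \<and> connected \<Omega> \<and> \<Omega> \<noteq> {} \<and> smooth_boundary \<Omega>"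

definition grad :: "(real^'n \<Rightarrow> real) \<Rightarrow> real^'n \<Rightarrow> real^'n" where
  "grad \<phi> x = (\<chi> i. frechet_derivative \<phi> (at x) (axis i 1))"

definition hessian :: "(real^'n \<Rightarrow> real) \<Rightarrow> real^'n \<Rightarrow> real^'n^'n" where
  "hessian \<phi> x = jacobian (grad \<phi>) (at x)"

definition inf_laplacian :: "(real^'n \<Rightarrow> real) \<Rightarrow> real^'n \<Rightarrow> real" where
  "inf_laplacian \<phi> x = grad \<phi> x \<bullet> (hessian \<phi> x *v grad \<phi> x)"

definition usc_on :: "'a::topological_space set \<Rightarrow> ('a \<Rightarrow> real) \<Rightarrow> bool" where
  "usc_on S u \<longleftrightarrow> (\<forall>x\<in>S. \<forall>c. u x < c \<longrightarrow> (\<forall>\<^sub>F y in at x within S. u y < c))"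

definition lsc_on :: "'a::topological_space set \<Rightarrow> ('a \<Rightarrow> real) \<Rightarrow> bool" where
  "lsc_on S u \<longleftrightarrow> (\<forall>x\<in>S. \<forall>c. c < u x \<longrightarrow> (\<forall>\<^sub>F y in at x within S. c < u y))"

(* The filter at x0 within S leaves out x0 itself. *)
definition strict_local_max_at ::
  "'a::topological_space set \<Rightarrow> ('a \<Rightarrow> real) \<Rightarrow> 'a \<Rightarrow> bool" where
  "strict_local_max_at S f x0 \<longleftrightarrow> (\<forall>\<^sub>F x in at x0 within S. f x < f x0)"

definition strict_local_min_at ::
  "'a::topological_space set \<Rightarrow> ('a \<Rightarrow> real) \<Rightarrow> 'a \<Rightarrow> bool" where
  "strict_local_min_at S f x0 \<longleftrightarrow> (\<forall>\<^sub>F x in at x0 within S. f x0 < f x)"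

definition viscosity_subsolution :: "(real^'n) set \<Rightarrow> (real^'n \<Rightarrow> real) \<Rightarrow> bool" where
  "viscosity_subsolution \<Omega> u \<longleftrightarrow>
     usc_on \<Omega> u \<and>
     (\<forall>x0\<in>\<Omega>. \<forall>\<phi>. Ck_on 2 \<Omega> \<phi> \<longrightarrow> strict_local_max_at \<Omega> (\<lambda>x. u x - \<phi> x) x0 \<longrightarrow>
        max (- inf_laplacian \<phi> x0) (indicator {x\<in>\<Omega>. u x > 0} x0 - norm (grad \<phi> x0)) \<le> 0)"

definition viscosity_supersolution :: "(real^'n) set \<Rightarrow> (real^'n \<Rightarrow> real) \<Rightarrow> bool" where
  "viscosity_supersolution \<Omega> u \<longleftrightarrow>
     lsc_on \<Omega> u \<and>
     (\<forall>x0\<in>\<Omega>. \<forall>\<phi>. Ck_on 2 \<Omega> \<phi> \<longrightarrow> strict_local_min_at \<Omega> (\<lambda>x. u x - \<phi> x) x0 \<longrightarrow>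
        max (- inf_laplacian \<phi> x0) (indicator {x\<in>\<Omega>. u x \<ge> 0} x0 - norm (grad \<phi> x0)) \<ge> 0)"

definition viscosity_solution :: "(real^'n) set \<Rightarrow> (real^'n \<Rightarrow> real) \<Rightarrow> bool" where
  "viscosity_solution \<Omega> u \<longleftrightarrow>
     continuous_on \<Omega> u \<and> viscosity_subsolution \<Omega> u \<and> viscosity_supersolution \<Omega> u"

definition dirichlet_solution ::
  "(real^'n) set \<Rightarrow> (real^'n \<Rightarrow> real) \<Rightarrow> (real^'n \<Rightarrow> real) \<Rightarrow> bool" where
  "dirichlet_solution \<Omega> g u \<longleftrightarrow>
     viscosity_solution \<Omega> u \<and> continuous_on (closure \<Omega>) u \<and> (\<forall>x\<in>frontier \<Omega>. u x = g x)"

end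

(*
  Comparison is a form of the argument of Armstrong and Smart. A subsolution u lies below cones, and
  where u > 0 its maximum over a ball of radius r about x is at least u x + r; a supersolution v lies
  above cones wherever v < 0, and above cones of slope at least 1 everywhere. For p x = sup of u and
  q x = sup of -v over the ball of radius \<epsilon> about x this gives discrete inequalities. If u - v had
  a positive maximum exceeding its boundary values, then one could take a maximum point of p + q
  that, among all such points, maximizes p and, among those, a linear functional; the discrete
  inequalities produce a point in the \<epsilon>-ball that contradicts one of these choices.

  Existence is Perron's method. Cones with vertices on the boundary and slope at least the Lipschitz
  constant of g and at least 1 are barriers, and comparison with cones makes the competitors
  locally equi-Lipschitz, so that their supremum is continuous.
*)

theory Submission
  imports Defs
begin

section \<open>Twice continuously differentiable functions\<close>

text \<open>The two characteristic functions do not match: a subsolution is constrained where u > 0,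
  a supersolution relaxed where v >= 0. They are reconciled at a positive maximum of u - v, because
  on a small scale \<epsilon> one of two regimes applies there. If v < 0 nearby, or if -v rises with
  slope at least 1, both functions satisfy the midpoint inequality of infinity-harmonic functions.
  Otherwise v >= 0 somewhere nearby, which forces u to be positive; then p gains at least \<epsilon>
  while q gains at most \<epsilon>. Neither regime yields a strict inequality, and no perturbation
  to a strict subsolution is made: equality is tolerated and then excluded by the successive choices
  of the maximum point. Working with suprema over balls also keeps second derivatives out of the
  comparison argument, which rests on cones only.

  The technical obstacle is that cones are not admissible test functions. They must be bent to get a
  sign for the infinity Laplacian, rounded at the vertex to be C2 on all of \<Omega>, and they touch
  only non-strictly, whereas the definitions ask for strict extrema.\<close>

definition C2_on ::
  "(real^'n) set \<Rightarrow> (real^'n \<Rightarrow> real) \<Rightarrow> (real^'n \<Rightarrow> real^'n) \<Rightarrow> (real^'n \<Rightarrow> real^'n \<Rightarrow> real^'n) \<Rightarrow> bool"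
  where "C2_on S f G D \<longleftrightarrow>
    (\<forall>x\<in>S. (f has_derivative (\<lambda>v. G x \<bullet> v)) (at x) \<and> (G has_derivative D x) (at x)) \<and>
    (\<forall>v. continuous_on S (\<lambda>x. D x v))"

lemma C2_onD:
  assumes "C2_on S f G D"
  shows "x \<in> S \<Longrightarrow> (f has_derivative (\<lambda>v. G x \<bullet> v)) (at x)"
    and "x \<in> S \<Longrightarrow> (G has_derivative D x) (at x)"
    and "continuous_on S (\<lambda>x. D x v)"
  using assms by (auto simp: C2_on_def)

lemma grad_eqI:
  assumes "(f has_derivative (\<lambda>v. G \<bullet> v)) (at x)"
  shows "grad f x = G"
  unfolding grad_def frechet_derivative_at[OF assms, symmetric]
  by (simp add: vec_eq_iff inner_axis)

lemma hessian_eqI: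
  assumes "open S" "x \<in> S" "\<And>y. y \<in> S \<Longrightarrow> grad f y = G y" "(G has_derivative D) (at x)"
  shows "hessian f x *v v = D v"
proof -
  have "(grad f has_derivative D) (at x)"
    using has_derivative_transform_within_open[OF assms(4,1,2)] assms(3) by simp
  moreover from this have "(grad f has_derivative (\<lambda>h. jacobian (grad f) (at x) *v h)) (at x)"
    using jacobian_works differentiableI by blast
  ultimately show ?thesis
    unfolding hessian_def using has_derivative_unique by metis
qed

text \<open>\<open>C2_on\<close> carries the gradient and its derivative as explicit witnesses, so
  that derivative rules apply to them. Here the witnesses are identified with \<open>grad\<close>
  and \<open>hessian\<close>; openness of \<open>S\<close> enters because \<open>hessian\<close> at
  a point depends on \<open>grad\<close> in a neighbourhood.\<close>

lemma C2_on_imp: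
  assumes S: "open S" and C: "C2_on S f G D"
  shows C2_on_imp_Ck_on: "Ck_on 2 S f"
    and C2_on_imp_grad: "x \<in> S \<Longrightarrow> grad f x = G x"
    and C2_on_imp_hessian: "x \<in> S \<Longrightarrow> hessian f x *v v = D x v"
    and C2_on_imp_inf_laplacian: "x \<in> S \<Longrightarrow> inf_laplacian f x = G x \<bullet> D x (G x)"
proof -
  show *: "grad f x = G x" if "x \<in> S" for x
    using C that by (intro grad_eqI C2_onD)
  show h: "hessian f x *v v = D x v" if "x \<in> S" for x v
    using hessian_eqI[OF S that * C2_onD(2)[OF C that]] .
  show "inf_laplacian f x = G x \<bullet> D x (G x)" if "x \<in> S" for x
    using * h that by (simp add: inf_laplacian_def)
  have fd: "frechet_derivative f (at x) = (\<lambda>v. G x \<bullet> v)" if "x \<in> S" for x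
    using frechet_derivative_at[OF C2_onD(1)[OF C that]] by simp
  have d2: "((\<lambda>x. frechet_derivative f (at x) v) has_derivative (\<lambda>w. D x w \<bullet> v)) (at x)"
    if "x \<in> S" for x v
  proof (rule has_derivative_transform_within_open[OF _ S that])
    show "((\<lambda>x. G x \<bullet> v) has_derivative (\<lambda>w. D x w \<bullet> v)) (at x)"
      using C2_onD(2)[OF C that] by (auto intro!: derivative_eq_intros)
  qed (simp add: fd)
  have fd2: "frechet_derivative (\<lambda>x. frechet_derivative f (at x) v) (at x) w = D x w \<bullet> v"
    if "x \<in> S" for x v w
    using frechet_derivative_at[OF d2[OF that]] by metis
  have "continuous_on S (\<lambda>x. frechet_derivative (\<lambda>x. frechet_derivative f (at x) v) (at x) w)" for v w
  proof -
    have "continuous_on S (\<lambda>x. D x w \<bullet> v)"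
      by (intro continuous_intros C2_onD[OF C])
    then show ?thesis
      by (rule continuous_on_eq) (simp add: fd2)
  qed
  then show "Ck_on 2 S f"
    using differentiableI[OF C2_onD(1)[OF C]] differentiableI[OF d2] by (simp add: numeral_2_eq_2)
qed

lemma frechet_derivative_grad:
  assumes "f differentiable (at x)"
  shows "frechet_derivative f (at x) v = grad f x \<bullet> v"
proof -
  interpret linear "frechet_derivative f (at x)"
    using assms by (rule linear_frechet_derivative)
  have "frechet_derivative f (at x) v = frechet_derivative f (at x) (\<Sum>i\<in>UNIV. v $ i *\<^sub>R axis i 1)"
    using basis_expansion[of v] by (simp add: scalar_mult_eq_scaleR)
  also have "\<dots> = grad f x \<bullet> v"
    by (simp add: sum scaleR grad_def inner_vec_def mult.commute)
  finally show ?thesis .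
qed

text \<open>\<open>Ck_on\<close> gives second derivatives only for one fixed direction at a time, so
  the derivative of \<open>grad f\<close> is assembled from its components.\<close>

lemma Ck_on_imp_C2_on:
  fixes f :: "real^'n \<Rightarrow> real"
  assumes S: "open S" and C: "Ck_on 2 S f"
  shows "C2_on S f (grad f) (\<lambda>x v. hessian f x *v v)"
proof -
  have 1: "f differentiable (at x)" if "x \<in> S" for x
    using C that by (simp add: numeral_2_eq_2)
  have 2: "(\<lambda>x. frechet_derivative f (at x) v) differentiable (at x)" if "x \<in> S" for x v
    using C that by (simp add: numeral_2_eq_2)
  have 3: "continuous_on S (\<lambda>x. frechet_derivative (\<lambda>x. frechet_derivative f (at x) v) (at x) w)" for v w
    using C by (simp add: numeral_2_eq_2)
  have 4: "(grad f has_derivative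
      (\<lambda>w. \<chi> i. frechet_derivative (\<lambda>x. frechet_derivative f (at x) (axis i 1)) (at x) w)) (at x)"
    if "x \<in> S" for x
  proof (rule has_derivative_componentwise_within[THEN iffD2], rule ballI)
    fix b :: "real^'n" assume "b \<in> Basis"
    then obtain i where b: "b = axis i 1"
      by (auto simp: Basis_vec_def)
    have "((\<lambda>x. frechet_derivative f (at x) (axis i 1)) has_derivative
        frechet_derivative (\<lambda>x. frechet_derivative f (at x) (axis i 1)) (at x)) (at x)"
      using 2[OF that] frechet_derivative_works by blast
    then show "((\<lambda>x. grad f x \<bullet> b) has_derivative (\<lambda>x'. (\<chi> i. frechet_derivative
        (\<lambda>x. frechet_derivative f (at x) (axis i 1)) (at x) x') \<bullet> b)) (at x)"
      by (simp add: b grad_def inner_axis)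
  qed
  have 5: "hessian f x *v v =
      (\<chi> i. frechet_derivative (\<lambda>x. frechet_derivative f (at x) (axis i 1)) (at x) v)" if "x \<in> S" for x v
    using hessian_eqI[OF S that refl 4[OF that]] .
  show ?thesis
    unfolding C2_on_def
  proof (intro conjI ballI allI)
    fix x assume x: "x \<in> S"
    show "(f has_derivative (\<lambda>v. grad f x \<bullet> v)) (at x)"
      using 1[OF x] frechet_derivative_works frechet_derivative_grad
      by (metis (no_types, lifting) ext has_derivative_eq_rhs)
    show "(grad f has_derivative (\<lambda>v. hessian f x *v v)) (at x)"
      using 4[OF x] 5[OF x] by simp
  next
    fix v
    show "continuous_on S (\<lambda>x. hessian f x *v v)"
      by (rule continuous_on_eq[where f = "\<lambda>x. \<chi> i. frechet_derivative
          (\<lambda>x. frechet_derivative f (at x) (axis i 1)) (at x) v"])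
        (auto intro!: continuous_intros 3 simp: 5)
  qed
qed

section \<open>Sums, negatives and radial functions\<close>

lemma C2_on_add:
  assumes "C2_on S f G D" "C2_on S g G' D'"
  shows "C2_on S (\<lambda>x. f x + g x) (\<lambda>x. G x + G' x) (\<lambda>x v. D x v + D' x v)"
  using assms unfolding C2_on_def
  by (auto intro!: continuous_intros derivative_eq_intros simp: inner_add_left fun_eq_iff)

lemma C2_on_uminus:
  assumes "C2_on S f G D"
  shows "C2_on S (\<lambda>x. - f x) (\<lambda>x. - G x) (\<lambda>x v. - D x v)"
  using assms unfolding C2_on_def
  by (auto intro!: continuous_intros derivative_eq_intros)

text \<open>The profile is a function of the squared distance because that is smooth at the vertex
  \<open>y\<close> too; everything then follows from the chain rule without a case
  distinction.\<close>

lemma C2_on_radial: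
  fixes y :: "real^'n"
  assumes F: "\<And>x. x \<in> S \<Longrightarrow> (F has_real_derivative F' ((norm (x - y))\<^sup>2)) (at ((norm (x - y))\<^sup>2))"
    and F': "\<And>x. x \<in> S \<Longrightarrow> (F' has_real_derivative F'' ((norm (x - y))\<^sup>2)) (at ((norm (x - y))\<^sup>2))"
    and F'': "continuous_on S (\<lambda>x. F'' ((norm (x - y))\<^sup>2))"
  shows "C2_on S (\<lambda>x. F ((norm (x - y))\<^sup>2)) (\<lambda>x. (2 * F' ((norm (x - y))\<^sup>2)) *\<^sub>R (x - y))
    (\<lambda>x v. (4 * F'' ((norm (x - y))\<^sup>2) * ((x - y) \<bullet> v)) *\<^sub>R (x - y) + (2 * F' ((norm (x - y))\<^sup>2)) *\<^sub>R v)"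
proof -
  have n: "((\<lambda>x. (norm (x - y))\<^sup>2) has_derivative (\<lambda>v. 2 * ((x - y) \<bullet> v))) (at x)" for x
    unfolding power2_norm_eq_inner
    by (auto intro!: derivative_eq_intros simp: inner_commute)
  have a: "((\<lambda>x. F ((norm (x - y))\<^sup>2)) has_derivative
      (\<lambda>v. F' ((norm (x - y))\<^sup>2) * (2 * ((x - y) \<bullet> v)))) (at x)" if "x \<in> S" for x
    using has_derivative_compose[OF n F[OF that, unfolded has_field_derivative_def]] .
  have b: "((\<lambda>x. F' ((norm (x - y))\<^sup>2)) has_derivative
      (\<lambda>v. F'' ((norm (x - y))\<^sup>2) * (2 * ((x - y) \<bullet> v)))) (at x)" if "x \<in> S" for x
    using has_derivative_compose[OF n F'[OF that, unfolded has_field_derivative_def]] .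
  have c: "((\<lambda>x. (2 * F' ((norm (x - y))\<^sup>2)) *\<^sub>R (x - y)) has_derivative
      (\<lambda>v. (4 * F'' ((norm (x - y))\<^sup>2) * ((x - y) \<bullet> v)) *\<^sub>R (x - y) + (2 * F' ((norm (x - y))\<^sup>2)) *\<^sub>R v))
      (at x)" if "x \<in> S" for x
    by (rule derivative_eq_intros b[OF that] refl | simp add: algebra_simps)+
  have "continuous_on S (\<lambda>x. F' ((norm (x - y))\<^sup>2))"
    using b has_derivative_continuous by (blast intro: continuous_at_imp_continuous_on)
  with F'' have d: "continuous_on S (\<lambda>x. (4 * F'' ((norm (x - y))\<^sup>2) * ((x - y) \<bullet> v)) *\<^sub>R (x - y)
      + (2 * F' ((norm (x - y))\<^sup>2)) *\<^sub>R v)" for v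
    by (intro continuous_intros)
  show ?thesis
    unfolding C2_on_def using c d
    by (auto intro!: has_derivative_eq_rhs[OF a] simp: fun_eq_iff)
qed

lemma C2_on_square_dist:
  "C2_on S (\<lambda>x::real^'n. k * (norm (x - y))\<^sup>2) (\<lambda>x. (2 * k) *\<^sub>R (x - y)) (\<lambda>x v. (2 * k) *\<^sub>R v)"
proof -
  have "C2_on S (\<lambda>x. (\<lambda>s. k * s) ((norm (x - y))\<^sup>2)) (\<lambda>x. (2 * k) *\<^sub>R (x - y))
    (\<lambda>x v. (4 * 0 * ((x - y) \<bullet> v)) *\<^sub>R (x - y) + (2 * k) *\<^sub>R v)"
    by (rule C2_on_radial) (auto intro!: derivative_eq_intros)
  then show ?thesis by simp
qed

text \<open>With \<open>b\<close> and \<open>c\<close> the first and second derivative of the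
  profile in the squared distance, the right-hand side is the square of the radial derivative times
  the second radial derivative.\<close>

lemma radial_inf_laplacian:
  fixes r :: "real^'n" and b c :: real
  defines "G \<equiv> (2 * b) *\<^sub>R r"
  shows "G \<bullet> ((4 * c * (r \<bullet> G)) *\<^sub>R r + (2 * b) *\<^sub>R G) = 8 * b\<^sup>2 * (norm r)\<^sup>2 * (2 * c * (norm r)\<^sup>2 + b)"
  unfolding G_def power2_norm_eq_inner by (simp add: inner_add_right power2_eq_square algebra_simps)

lemma inf_laplacian_continuous_on:
  assumes "open S" "Ck_on 2 S f"
  shows grad_continuous_on: "continuous_on S (grad f)"
    and "continuous_on S (inf_laplacian f)"
proof -
  note C = Ck_on_imp_C2_on[OF assms]
  show g: "continuous_on S (grad f)"
    using C2_onD(2)[OF C] has_derivative_continuous by (blast intro: continuous_at_imp_continuous_on)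
  have e: "continuous_on S (\<lambda>x. hessian f x $ i $ j)" for i j
  proof -
    have "continuous_on S (\<lambda>x. (hessian f x *v axis j 1) $ i)"
      by (intro continuous_intros C2_onD(3)[OF C])
    then show ?thesis
      by (simp add: matrix_vector_mult_basis column_def)
  qed
  show "continuous_on S (inf_laplacian f)"
    unfolding inf_laplacian_def matrix_vector_mult_def
    by (intro continuous_intros g e)
qed

lemma local_min_C2:
  assumes S: "open S" "x \<in> S" and C: "C2_on S f G D"
    and m: "\<forall>\<^sub>F z in nhds x. f x \<le> f z"
  shows "G x = 0" and "0 \<le> v \<bullet> D x v"
proof -
  have nh: "\<forall>\<^sub>F t in nhds (0::real). P (x + t *\<^sub>R v)" if "\<forall>\<^sub>F z in nhds x. P z" for P and v
  proof -
    have "((\<lambda>t. x + t *\<^sub>R v) \<longlongrightarrow> x + 0 *\<^sub>R v) (nhds 0)"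
      by (intro tendsto_intros filterlim_ident)
    then show ?thesis
      using that by (simp add: filterlim_iff)
  qed
  have d1: "((\<lambda>t. f (x + t *\<^sub>R v)) has_real_derivative G (x + t *\<^sub>R v) \<bullet> v) (at t)"
    if "x + t *\<^sub>R v \<in> S" for t v
  proof -
    have "((\<lambda>t. f (x + t *\<^sub>R v)) has_derivative (\<lambda>h. G (x + t *\<^sub>R v) \<bullet> (h *\<^sub>R v))) (at t)"
      by (rule has_derivative_compose[where f = "\<lambda>t. x + t *\<^sub>R v", OF _ C2_onD(1)[OF C that]])
        (auto intro!: derivative_eq_intros)
    then show ?thesis
      by (simp add: has_field_derivative_def mult_commute_abs)
  qed
  have g0: "G x \<bullet> v = 0" for v
  proof -
    obtain d where "d > 0" "\<And>t. \<bar>t\<bar> < d \<Longrightarrow> f x \<le> f (x + t *\<^sub>R v)"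
      using nh[OF m] unfolding eventually_nhds_metric by (force simp: dist_real_def)
    then show ?thesis
      using DERIV_local_min[of "\<lambda>t. f (x + t *\<^sub>R v)" "G x \<bullet> v" 0 d] d1[of 0 v] S by simp
  qed
  from this[of "G x"] show "G x = 0" by simp
  show "0 \<le> v \<bullet> D x v"
  \<comment> \<open>\<open>v \<bullet> D x v\<close> is the second derivative of \<open>f\<close>
    along the line through \<open>x\<close> in direction \<open>v\<close>. If it were negative, the
    first derivative, zero at 0, would be negative just afterwards, and the mean value theorem would
    give a value below \<open>f x\<close>.\<close>
  proof (rule ccontr)
    assume neg: "\<not> 0 \<le> v \<bullet> D x v"
    have "((\<lambda>t. G (x + t *\<^sub>R v)) has_derivative (\<lambda>h. D x (h *\<^sub>R v))) (at 0)"
      by (rule has_derivative_compose[where f = "\<lambda>t. x + t *\<^sub>R v" and g = G])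
        (use C2_onD(2)[OF C] S in \<open>auto intro!: derivative_eq_intros\<close>)
    then have "((\<lambda>t. G (x + t *\<^sub>R v) \<bullet> v) has_derivative (\<lambda>h. D x (h *\<^sub>R v) \<bullet> v)) (at 0)"
      by (auto intro!: derivative_eq_intros)
    moreover have "linear (D x)"
      using C2_onD(2)[OF C] S has_derivative_linear by blast
    ultimately have "((\<lambda>t. G (x + t *\<^sub>R v) \<bullet> v) has_real_derivative (v \<bullet> D x v)) (at 0)"
      by (simp add: has_field_derivative_def linear_scale mult_commute_abs inner_commute)
    then obtain d where d: "d > 0" "\<And>h. 0 < h \<Longrightarrow> h < d \<Longrightarrow> G (x + h *\<^sub>R v) \<bullet> v < 0"
      using DERIV_neg_dec_right[of "\<lambda>t. G (x + t *\<^sub>R v) \<bullet> v" "v \<bullet> D x v" 0] neg g0[of v] by auto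
    have "\<forall>\<^sub>F t in nhds 0. f x \<le> f (x + t *\<^sub>R v) \<and> x + t *\<^sub>R v \<in> S"
      using nh[OF m, of v] nh[OF eventually_nhds_in_open[OF S], of v] by (rule eventually_conj)
    then obtain d' where d': "d' > 0" "\<And>t. \<bar>t\<bar> < d' \<Longrightarrow> f x \<le> f (x + t *\<^sub>R v) \<and> x + t *\<^sub>R v \<in> S"
      unfolding eventually_nhds_metric by (force simp: dist_real_def)
    define b where "b = min d d' / 2"
    have b: "0 < b" "b < d" "b < d'"
      using d(1) d'(1) by (auto simp: b_def)
    obtain z where z: "0 < z" "z < b"
      "f (x + b *\<^sub>R v) - f (x + 0 *\<^sub>R v) = (b - 0) * (G (x + z *\<^sub>R v) \<bullet> v)"
      using MVT2[of 0 b "\<lambda>t. f (x + t *\<^sub>R v)" "\<lambda>t. G (x + t *\<^sub>R v) \<bullet> v"] b d1 d'(2) by auto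
    moreover have "b * (G (x + z *\<^sub>R v) \<bullet> v) < 0"
      using b d(2)[of z] z by (simp add: mult_pos_neg)
    ultimately show False
      using d'(2)[of b] b by simp
  qed
qed

section \<open>Touching by non-strict extrema and smoothed cones\<close>

text \<open>A quadratic penalty centred at the touching point makes touching strict. It leaves the
  gradient there unchanged and shifts the infinity Laplacian by a term linear in
  \<open>k\<close>.\<close>

lemma perturbed_test_function:
  fixes k :: real
  assumes S: "open S" and x: "x \<in> S" and C: "Ck_on 2 S \<phi>"
  defines "\<psi> \<equiv> \<lambda>z. \<phi> z + k * (norm (z - x))\<^sup>2"
  shows "Ck_on 2 S \<psi>" "grad \<psi> x = grad \<phi> x"
    "inf_laplacian \<psi> x = inf_laplacian \<phi> x + 2 * k * (norm (grad \<phi> x))\<^sup>2"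
proof -
  note C2 = C2_on_add[OF Ck_on_imp_C2_on[OF S C] C2_on_square_dist[of S k x], folded \<psi>_def]
  show "Ck_on 2 S \<psi>" "grad \<psi> x = grad \<phi> x"
    using C2_on_imp(1,2)[OF S C2] x by auto
  show "inf_laplacian \<psi> x = inf_laplacian \<phi> x + 2 * k * (norm (grad \<phi> x))\<^sup>2"
    using C2_on_imp(4)[OF S C2 x]
    by (simp add: inner_add_right power2_norm_eq_inner inf_laplacian_def[of \<phi>])
qed

lemma eventually_at_eq_nhds_le:
  fixes f :: "'a::topological_space \<Rightarrow> real"
  assumes "open S" "x \<in> S"
  shows "(\<forall>\<^sub>F z in at x within S. f z < f x) \<Longrightarrow> (\<forall>\<^sub>F z in nhds x. f z \<le> f x)"
    and "(\<forall>\<^sub>F z in at x within S. f x < f z) \<Longrightarrow> (\<forall>\<^sub>F z in nhds x. f x \<le> f z)"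
  unfolding at_within_open[OF assms(2,1)] eventually_at_filter
  by (auto elim!: eventually_mono)

text \<open>Test functions found by maximizing over compact sets touch only non-strictly. The
  penalty makes the touching strict, and its effect on the infinity Laplacian vanishes as
  \<open>k\<close> tends to 0.\<close>

lemma viscosity_subsolution_iff:
  assumes S: "open \<Omega>"
  shows "viscosity_subsolution \<Omega> u \<longleftrightarrow> usc_on \<Omega> u \<and>
    (\<forall>x\<in>\<Omega>. \<forall>\<phi>. Ck_on 2 \<Omega> \<phi> \<longrightarrow> (\<forall>\<^sub>F z in nhds x. u z - \<phi> z \<le> u x - \<phi> x) \<longrightarrow>
      0 \<le> inf_laplacian \<phi> x \<and> (0 < u x \<longrightarrow> 1 \<le> norm (grad \<phi> x)))"
    (is "_ \<longleftrightarrow> _ \<and> ?R")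
proof
  assume L: "viscosity_subsolution \<Omega> u"
  have "0 \<le> inf_laplacian \<phi> x \<and> (0 < u x \<longrightarrow> 1 \<le> norm (grad \<phi> x))"
    if x: "x \<in> \<Omega>" and C: "Ck_on 2 \<Omega> \<phi>" and m: "\<forall>\<^sub>F z in nhds x. u z - \<phi> z \<le> u x - \<phi> x" for x \<phi>
  proof -
    have *: "0 \<le> inf_laplacian \<phi> x + 2 * k * (norm (grad \<phi> x))\<^sup>2 \<and> (0 < u x \<longrightarrow> 1 \<le> norm (grad \<phi> x))"
      if k: "k > 0" for k
    proof -
      note P = perturbed_test_function[OF S x C, of k]
      have pos: "z \<noteq> x \<Longrightarrow> 0 < k * (norm (z - x))\<^sup>2" for z
        using k by simp
      have "strict_local_max_at \<Omega> (\<lambda>z. u z - (\<phi> z + k * (norm (z - x))\<^sup>2)) x"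
        unfolding strict_local_max_at_def at_within_open[OF x S] eventually_at_filter
        using m by (rule eventually_mono) (simp, smt (verit) pos)
      then have "max (- inf_laplacian (\<lambda>z. \<phi> z + k * (norm (z - x))\<^sup>2) x)
        (indicator {x\<in>\<Omega>. u x > 0} x - norm (grad (\<lambda>z. \<phi> z + k * (norm (z - x))\<^sup>2) x)) \<le> 0"
        using L x P(1) unfolding viscosity_subsolution_def by blast
      then show ?thesis
        unfolding P(2,3) using x by (auto simp: indicator_def)
    qed
    have "0 \<le> inf_laplacian \<phi> x"
    proof (rule ccontr)
      assume n: "\<not> 0 \<le> inf_laplacian \<phi> x"
      define N where "N = (norm (grad \<phi> x))\<^sup>2"
      have "N \<ge> 0" by (simp add: N_def)
      \<comment> \<open>Small enough that the shift \<open>2 * k * N\<close> uses up at most half of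
        the negative infinity Laplacian; the summand 1 allows for a vanishing gradient.\<close>
      define k where "k = - inf_laplacian \<phi> x / (4 * (N + 1))"
      have "k > 0"
        using n \<open>N \<ge> 0\<close> by (simp add: k_def divide_neg_pos)
      have "k * N \<le> k * (N + 1)"
        using \<open>k > 0\<close> by simp
      also have "\<dots> = - inf_laplacian \<phi> x / 4"
        using \<open>N \<ge> 0\<close> by (simp add: k_def divide_simps)
      finally show False
        using *[OF \<open>k > 0\<close>] n unfolding N_def by auto
    qed
    then show ?thesis using *[of 1] by auto
  qed
  then show "usc_on \<Omega> u \<and> ?R"
    using L unfolding viscosity_subsolution_def by blast
next
  assume R: "usc_on \<Omega> u \<and> ?R"
  show "viscosity_subsolution \<Omega> u"
    unfolding viscosity_subsolution_def
  proof (intro conjI ballI allI impI)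
    fix x \<phi> assume x: "x \<in> \<Omega>" and C: "Ck_on 2 \<Omega> \<phi>" and "strict_local_max_at \<Omega> (\<lambda>x. u x - \<phi> x) x"
    then have "\<forall>\<^sub>F z in nhds x. u z - \<phi> z \<le> u x - \<phi> x"
      using eventually_at_eq_nhds_le(1)[OF S x, of "\<lambda>x. u x - \<phi> x"]
      by (simp add: strict_local_max_at_def)
    then show "max (- inf_laplacian \<phi> x) (indicator {x\<in>\<Omega>. u x > 0} x - norm (grad \<phi> x)) \<le> 0"
      using R x C by (auto simp: indicator_def)
  qed (use R in blast)
qed

text \<open>For \<open>v x < 0\<close> the second entry of the maximum is minus the gradient norm.
  It is nonnegative only if the gradient vanishes, and then so does the infinity Laplacian; hence
  the second alternative can be restricted to \<open>0 \<le> v x\<close>.\<close>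

lemma viscosity_supersolution_iff:
  assumes S: "open \<Omega>"
  shows "viscosity_supersolution \<Omega> v \<longleftrightarrow> lsc_on \<Omega> v \<and>
    (\<forall>x\<in>\<Omega>. \<forall>\<phi>. Ck_on 2 \<Omega> \<phi> \<longrightarrow> (\<forall>\<^sub>F z in nhds x. v x - \<phi> x \<le> v z - \<phi> z) \<longrightarrow>
      inf_laplacian \<phi> x \<le> 0 \<or> 0 \<le> v x \<and> norm (grad \<phi> x) \<le> 1)"
    (is "_ \<longleftrightarrow> _ \<and> ?R")
proof
  assume L: "viscosity_supersolution \<Omega> v"
  have "inf_laplacian \<phi> x \<le> 0 \<or> 0 \<le> v x \<and> norm (grad \<phi> x) \<le> 1"
    if x: "x \<in> \<Omega>" and C: "Ck_on 2 \<Omega> \<phi>" and m: "\<forall>\<^sub>F z in nhds x. v x - \<phi> x \<le> v z - \<phi> z" for x \<phi>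
  proof (rule ccontr)
    assume n: "\<not> ?thesis"
    define N where "N = (norm (grad \<phi> x))\<^sup>2"
    have "grad \<phi> x \<noteq> 0"
      using n by (auto simp: inf_laplacian_def)
    then have "N > 0" by (simp add: N_def)
    \<comment> \<open>Subtracting the penalty with this \<open>k\<close> halves the infinity
      Laplacian, which therefore stays positive. Division by \<open>N\<close> is possible since a
      positive infinity Laplacian forces a nonzero gradient.\<close>
    define k where "k = inf_laplacian \<phi> x / (4 * N)"
    have "k > 0"
      using n \<open>N > 0\<close> by (simp add: k_def)
    note P = perturbed_test_function[OF S x C, of "- k"]
    have pos: "z \<noteq> x \<Longrightarrow> 0 < k * (norm (z - x))\<^sup>2" for z
      using \<open>k > 0\<close> by simp
    have "strict_local_min_at \<Omega> (\<lambda>z. v z - (\<phi> z + - k * (norm (z - x))\<^sup>2)) x"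
      unfolding strict_local_min_at_def at_within_open[OF x S] eventually_at_filter
      using m by (rule eventually_mono) (simp, smt (verit) pos)
    then have "max (- inf_laplacian (\<lambda>z. \<phi> z + - k * (norm (z - x))\<^sup>2) x)
      (indicator {x\<in>\<Omega>. v x \<ge> 0} x - norm (grad (\<lambda>z. \<phi> z + - k * (norm (z - x))\<^sup>2) x)) \<ge> 0"
      using L x P(1) unfolding viscosity_supersolution_def by blast
    moreover have "2 * - k * N = - inf_laplacian \<phi> x / 2"
      using \<open>N > 0\<close> by (simp add: k_def)
    ultimately show False
      unfolding P(2,3) N_def[symmetric] using n x \<open>grad \<phi> x \<noteq> 0\<close>
      by (cases "0 \<le> v x") (auto simp: max_def split: if_splits)
  qed
  then show "lsc_on \<Omega> v \<and> ?R"
    using L unfolding viscosity_supersolution_def by blast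
next
  assume R: "lsc_on \<Omega> v \<and> ?R"
  show "viscosity_supersolution \<Omega> v"
    unfolding viscosity_supersolution_def
  proof (intro conjI ballI allI impI)
    fix x \<phi> assume x: "x \<in> \<Omega>" and C: "Ck_on 2 \<Omega> \<phi>" and "strict_local_min_at \<Omega> (\<lambda>x. v x - \<phi> x) x"
    then have "\<forall>\<^sub>F z in nhds x. v x - \<phi> x \<le> v z - \<phi> z"
      using eventually_at_eq_nhds_le(2)[OF S x, of "\<lambda>x. v x - \<phi> x"]
      by (simp add: strict_local_min_at_def)
    then have "inf_laplacian \<phi> x \<le> 0 \<or> 0 \<le> v x \<and> norm (grad \<phi> x) \<le> 1"
      using R x C by blast
    then show "max (- inf_laplacian \<phi> x) (indicator {x\<in>\<Omega>. v x \<ge> 0} x - norm (grad \<phi> x)) \<ge> 0"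
      using x by (auto simp: indicator_def le_max_iff_disj)
  qed (use R in blast)
qed

lemma continuous_on_imp_semicontinuous:
  assumes "continuous_on S u"
  shows "usc_on S u" "lsc_on S u"
  using assms unfolding usc_on_def lsc_on_def continuous_on_def
  by (auto dest: order_tendstoD)

text \<open>The cubic term moves the singularity of the square root off the half line \<open>s \<ge> 0\<close>, so that
  composing with \<open>s = (norm (x - y))\<^sup>2\<close> gives a cone which is smooth at its vertex \<open>y\<close> and
  unchanged for \<open>s > s0\<close>.\<close>

definition smooth_sqrt :: "real \<Rightarrow> real \<Rightarrow> real" where
  "smooth_sqrt s0 s = sqrt (s + (max 0 (s0 - s)) ^ 3)"

text \<open>Only \<open>t = 0\<close> needs care: there the difference quotient is bounded by the
  next lower truncated power. Applied to the exponents 3 and 2 this makes the truncated cube twice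
  continuously differentiable.\<close>

lemma has_real_derivative_max_power:
  "((\<lambda>t::real. (max 0 t) ^ Suc (Suc n)) has_real_derivative of_nat (n + 2) * (max 0 t) ^ Suc n) (at t)"
proof -
  consider "t > 0" | "t < 0" | "t = 0" by linarith
  then show ?thesis
  proof cases
    case 1
    have "((\<lambda>t::real. t ^ Suc (Suc n)) has_real_derivative of_nat (n + 2) * (max 0 t) ^ Suc n) (at t)"
      using DERIV_pow[of "Suc (Suc n)" t UNIV] 1 by simp
    then show ?thesis
      by (rule DERIV_cong_ev[THEN iffD1, rotated -1, OF _ refl _ refl])
        (use 1 in \<open>auto intro: eventually_mono[OF eventually_nhds_in_open[of "{0<..}"]]\<close>)
  next
    case 2
    have "((\<lambda>t::real. 0) has_real_derivative of_nat (n + 2) * (max 0 t) ^ Suc n) (at t)"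
      using 2 by auto
    then show ?thesis
      by (rule DERIV_cong_ev[THEN iffD1, rotated -1, OF _ refl _ refl])
        (use 2 in \<open>auto intro: eventually_mono[OF eventually_nhds_in_open[of "{..<0}"]]\<close>)
  next
    case 3
    have "((\<lambda>h::real. (max 0 h) ^ Suc (Suc n) / h) \<longlongrightarrow> 0) (at 0)"
    proof (rule Lim_null_comparison)
      show "\<forall>\<^sub>F h in at 0. norm ((max 0 h) ^ Suc (Suc n) / h) \<le> (max 0 h) ^ Suc n"
        by (auto simp: max_def)
      have "((\<lambda>h::real. (max 0 h) ^ Suc n) \<longlongrightarrow> (max 0 0) ^ Suc n) (at 0)"
        by (intro tendsto_intros)
      then show "((\<lambda>h::real. (max 0 h) ^ Suc n) \<longlongrightarrow> 0) (at 0)" by simp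
    qed
    then show ?thesis
      using 3 by (simp add: has_field_derivative_iff)
  qed
qed

lemma smooth_sqrt_derivatives:
  assumes "s0 > 0" "s \<ge> 0"
  defines "q \<equiv> \<lambda>s. s + (max 0 (s0 - s)) ^ 3"
    and "q' \<equiv> \<lambda>s. 1 - 3 * (max 0 (s0 - s)) ^ 2" and "q'' \<equiv> \<lambda>s. 6 * max 0 (s0 - s)"
  shows "q s > 0"
    and "(smooth_sqrt s0 has_real_derivative q' s / (2 * sqrt (q s))) (at s)"
    and "((\<lambda>s. q' s / (2 * sqrt (q s))) has_real_derivative
      q'' s / (2 * sqrt (q s)) - (q' s)\<^sup>2 / (4 * sqrt (q s) * q s)) (at s)"
proof -
  show q: "q s > 0"
    using assms(1,2) by (cases "s = 0") (auto simp: q_def add_pos_nonneg)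
  have d: "((\<lambda>s. s0 - s) has_real_derivative - 1) (at s)"
    by (auto intro!: derivative_eq_intros)
  have 3: "((\<lambda>s. (max 0 (s0 - s)) ^ 3) has_real_derivative - (3 * (max 0 (s0 - s))\<^sup>2)) (at s)"
    using DERIV_chain2[where f = "\<lambda>t. max 0 t ^ Suc (Suc 1)", OF has_real_derivative_max_power d]
    by (simp add: numeral_3_eq_3 power2_eq_square)
  have 2: "((\<lambda>s. (max 0 (s0 - s)) ^ 2) has_real_derivative - (2 * max 0 (s0 - s))) (at s)"
    using DERIV_chain2[where f = "\<lambda>t. max 0 t ^ Suc (Suc 0)", OF has_real_derivative_max_power d]
    by (simp add: numeral_2_eq_2)
  have dq: "(q has_real_derivative q' s) (at s)"
    unfolding q_def q'_def by (rule derivative_eq_intros 3 refl | simp)+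
  have dq': "(q' has_real_derivative q'' s) (at s)"
    unfolding q'_def q''_def by (rule derivative_eq_intros 2 refl | simp)+
  have r: "((\<lambda>s. sqrt (q s)) has_real_derivative q' s / (2 * sqrt (q s))) (at s)"
    using DERIV_chain2[OF DERIV_real_sqrt[OF q] dq] by (simp add: field_simps)
  then show "(smooth_sqrt s0 has_real_derivative q' s / (2 * sqrt (q s))) (at s)"
    by (simp add: smooth_sqrt_def[abs_def] q_def)
  have e: "(a * (2 * r) - b * (2 * (b / (2 * r)))) / (2 * r * (2 * r)) = a / (2 * r) - b\<^sup>2 / (4 * r * (r * r))"
    if "r > 0" for a b r :: real
    using that by (simp add: field_simps power2_eq_square)
  have "sqrt (q s) > 0" "sqrt (q s) * sqrt (q s) = q s" using q by auto
  then show "((\<lambda>s. q' s / (2 * sqrt (q s))) has_real_derivative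
      q'' s / (2 * sqrt (q s)) - (q' s)\<^sup>2 / (4 * sqrt (q s) * q s)) (at s)"
    using DERIV_divide[OF dq' DERIV_cmult[OF r, of 2]] e[of "sqrt (q s)" "q'' s" "q' s"] by simp
qed

section \<open>Comparison with cones\<close>

text \<open>A test function has to be C2 on all of the domain, so the cone is rounded at its vertex;
  taking half the squared distance of \<open>x0\<close> as threshold keeps the change away from
  \<open>x0\<close>. As a function of the distance r the profile A r - \<delta> r^2 has derivatives
  A - 2 \<delta> r and -2 \<delta>, which give the gradient norm and the infinity Laplacian.\<close>

lemma smooth_cone:
  fixes x0 y :: "real^'n" and A b \<delta> :: real
  assumes "x0 \<noteq> y"
  obtains \<phi> where "Ck_on 2 UNIV \<phi>"
    and "\<forall>\<^sub>F z in nhds x0. \<phi> z = b + A * norm (z - y) - \<delta> * (norm (z - y))\<^sup>2"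
    and "norm (grad \<phi> x0) = \<bar>A - 2 * \<delta> * norm (x0 - y)\<bar>"
    and "inf_laplacian \<phi> x0 = - 2 * \<delta> * (A - 2 * \<delta> * norm (x0 - y))\<^sup>2"
proof -
  define t where "t = norm (x0 - y)"
  have t: "t > 0" using assms by (simp add: t_def)
  define s0 where "s0 = t\<^sup>2 / 2"
  have s0: "s0 > 0" "s0 < t\<^sup>2" using t by (auto simp: s0_def)
  define q where "q = (\<lambda>s. s + (max 0 (s0 - s)) ^ 3)"
  define q' where "q' = (\<lambda>s. 1 - 3 * (max 0 (s0 - s)) ^ 2)"
  define q'' where "q'' = (\<lambda>s. 6 * max 0 (s0 - s))"
  have d: "q s > 0" "(smooth_sqrt s0 has_real_derivative q' s / (2 * sqrt (q s))) (at s)"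
    "((\<lambda>s. q' s / (2 * sqrt (q s))) has_real_derivative
      q'' s / (2 * sqrt (q s)) - (q' s)\<^sup>2 / (4 * sqrt (q s) * q s)) (at s)" if "s \<ge> 0" for s
    unfolding q_def q'_def q''_def using smooth_sqrt_derivatives[OF s0(1) that] by blast+
  define F where "F = (\<lambda>s. b + A * smooth_sqrt s0 s - \<delta> * s)"
  define F' where "F' = (\<lambda>s. A * (q' s / (2 * sqrt (q s))) - \<delta>)"
  define F'' where "F'' = (\<lambda>s. A * (q'' s / (2 * sqrt (q s)) - (q' s)\<^sup>2 / (4 * sqrt (q s) * q s)))"
  have dF: "(F has_real_derivative F' s) (at s)" if "s \<ge> 0" for s
    unfolding F_def F'_def by (rule derivative_eq_intros d(2)[OF that] refl | simp)+
  have dF': "(F' has_real_derivative F'' s) (at s)" if "s \<ge> 0" for s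
    unfolding F'_def F''_def by (rule derivative_eq_intros d(3)[OF that] refl | simp)+
  have q0: "q ((norm (x - y))\<^sup>2) \<noteq> 0" for x
    using d(1)[of "(norm (x - y))\<^sup>2"] by simp
  have cq: "continuous_on UNIV (\<lambda>x. q ((norm (x - y))\<^sup>2))"
    "continuous_on UNIV (\<lambda>x. q' ((norm (x - y))\<^sup>2))"
    "continuous_on UNIV (\<lambda>x. q'' ((norm (x - y))\<^sup>2))"
    unfolding q_def q'_def q''_def by (intro continuous_intros)+
  have cF: "continuous_on UNIV (\<lambda>x. F'' ((norm (x - y))\<^sup>2))"
    unfolding F''_def by (intro continuous_intros cq) (use q0 in auto)
  define \<phi> where "\<phi> = (\<lambda>x. F ((norm (x - y))\<^sup>2))"
  note C2 = C2_on_radial[where S = UNIV and y = y, OF dF[OF zero_le_power2] dF'[OF zero_le_power2] cF, folded \<phi>_def]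
  have "q (t\<^sup>2) = t\<^sup>2" "q' (t\<^sup>2) = 1" "q'' (t\<^sup>2) = 0"
    using s0 by (auto simp: q_def q'_def q''_def)
  then have v: "F' (t\<^sup>2) = A / (2 * t) - \<delta>" "F'' (t\<^sup>2) = - A / (4 * t * t\<^sup>2)"
    using t by (auto simp: F'_def F''_def real_sqrt_abs)
  have v1: "2 * F' (t\<^sup>2) * t = A - 2 * \<delta> * t" "2 * F'' (t\<^sup>2) * t\<^sup>2 + F' (t\<^sup>2) = - \<delta>"
    unfolding v using t by (auto simp: field_simps)
  show thesis
  proof (rule that)
    show "Ck_on 2 UNIV \<phi>"
      using C2_on_imp(1)[OF open_UNIV C2] .
    have "\<forall>\<^sub>F z in nhds x0. z \<in> {z. s0 < (norm (z - y))\<^sup>2}"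
      by (rule eventually_nhds_in_open)
        (use s0 in \<open>auto intro!: open_Collect_less continuous_intros simp: t_def\<close>)
    then show "\<forall>\<^sub>F z in nhds x0. \<phi> z = b + A * norm (z - y) - \<delta> * (norm (z - y))\<^sup>2"
      by (rule eventually_mono) (simp add: \<phi>_def F_def smooth_sqrt_def)
    have "norm (grad \<phi> x0) = \<bar>2 * F' (t\<^sup>2) * t\<bar>"
      using C2_on_imp(2)[OF open_UNIV C2, of x0] by (simp add: t_def abs_mult)
    then show "norm (grad \<phi> x0) = \<bar>A - 2 * \<delta> * norm (x0 - y)\<bar>"
      unfolding v1 by (simp add: t_def)
    have "inf_laplacian \<phi> x0 = 8 * (F' (t\<^sup>2))\<^sup>2 * t\<^sup>2 * (2 * F'' (t\<^sup>2) * t\<^sup>2 + F' (t\<^sup>2))"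
      using C2_on_imp(4)[OF open_UNIV C2 UNIV_I, of x0] unfolding radial_inf_laplacian t_def .
    also have "\<dots> = 2 * (2 * F' (t\<^sup>2) * t)\<^sup>2 * (2 * F'' (t\<^sup>2) * t\<^sup>2 + F' (t\<^sup>2))"
      by (simp add: power2_eq_square)
    finally show "inf_laplacian \<phi> x0 = - 2 * \<delta> * (A - 2 * \<delta> * norm (x0 - y))\<^sup>2"
      unfolding v1 by (simp add: t_def)
  qed
qed

text \<open>Bending the cone slightly downwards makes its infinity Laplacian negative.\<close>

lemma cone_touching:
  fixes w :: "real^'n \<Rightarrow> real"
  assumes V: "open V" "bounded V" "y \<notin> V" and w: "continuous_on (closure V) w" and a: "0 \<le> a"
    and bd: "\<And>x. x \<in> frontier V \<Longrightarrow> w x \<le> b + a * norm (x - y)"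
    and p: "p \<in> V" "b + a * norm (p - y) < w p"
  obtains x0 \<phi> where "x0 \<in> V" "Ck_on 2 UNIV \<phi>" "\<forall>\<^sub>F z in nhds x0. w z - \<phi> z \<le> w x0 - \<phi> x0"
    "inf_laplacian \<phi> x0 < 0" "a < norm (grad \<phi> x0)"
proof -
  obtain B where B: "\<And>x. x \<in> closure V \<Longrightarrow> norm x \<le> B"
    using bounded_closure[OF V(2)] unfolding bounded_iff by blast
  define R where "R = B + norm y + 1"
  have R: "norm (x - y) < R" if "x \<in> closure V" for x
    using B[OF that] norm_triangle_ineq4[of x y] by (simp add: R_def)
  have pc: "p \<in> closure V" using p(1) closure_subset by blast
  have R0: "R > 0" using R[OF pc] norm_ge_zero[of "p - y"] by linarith
  define gap where "gap = w p - (b + a * norm (p - y))"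
  \<comment> \<open>At distance r < R from \<open>y\<close> the function \<open>f\<close> below
    exceeds the cone by \<delta> r (2 R - r). This is nonnegative and at most 2 R^2 \<delta>, half
    the gap, so \<open>p\<close> still violates the bound; and the slope a + 2 \<delta> (R - r)
    stays strictly above \<open>a\<close>.\<close>
  define \<delta> where "\<delta> = gap / (4 * R\<^sup>2)"
  have gap: "gap > 0" and \<delta>: "\<delta> > 0"
    using p R0 by (auto simp: gap_def \<delta>_def)
  define A where "A = a + 2 * R * \<delta>"
  define f where "f = (\<lambda>x. b + A * norm (x - y) - \<delta> * (norm (x - y))\<^sup>2)"
  have f: "f x = b + a * norm (x - y) + \<delta> * (norm (x - y) * (2 * R - norm (x - y)))" for x
    by (simp add: f_def A_def power2_eq_square algebra_simps)
  have f_ge: "b + a * norm (x - y) \<le> f x" if "x \<in> closure V" for x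
    unfolding f using R[OF that] \<delta> R0 by simp
  have f_p: "f p < w p"
  proof -
    have "norm (p - y) * (2 * R - norm (p - y)) \<le> R * (2 * R)"
      using R[OF pc] R0 by (intro mult_mono) auto
    then have "\<delta> * (norm (p - y) * (2 * R - norm (p - y))) \<le> \<delta> * (R * (2 * R))"
      using \<delta> by simp
    also have "\<dots> = gap / 2"
      using R0 by (simp add: \<delta>_def power2_eq_square field_simps)
    also have "\<dots> < gap" using gap by simp
    finally show ?thesis unfolding f gap_def by linarith
  qed
  have "continuous_on (closure V) (\<lambda>x. w x - f x)"
    unfolding f_def by (intro continuous_intros w)
  then obtain x0 where x0: "x0 \<in> closure V" "\<And>x. x \<in> closure V \<Longrightarrow> w x - f x \<le> w x0 - f x0"
    using continuous_attains_sup[of "closure V" "\<lambda>x. w x - f x"] p(1) V(2) by (auto simp: compact_closure)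
  have "x0 \<in> V"
  proof (rule ccontr)
    assume "x0 \<notin> V"
    then have "w x0 \<le> b + a * norm (x0 - y)"
      using x0(1) V(1) by (intro bd) (simp add: frontier_def interior_open)
    then show False
      using f_ge[OF x0(1)] f_p x0(2)[OF pc] by linarith
  qed
  then have "x0 \<noteq> y" using V(3) by blast
  then obtain \<phi> where \<phi>: "Ck_on 2 UNIV \<phi>" "\<forall>\<^sub>F z in nhds x0. \<phi> z = f z"
    "norm (grad \<phi> x0) = \<bar>A - 2 * \<delta> * norm (x0 - y)\<bar>"
    "inf_laplacian \<phi> x0 = - 2 * \<delta> * (A - 2 * \<delta> * norm (x0 - y))\<^sup>2"
    unfolding f_def by (rule smooth_cone)
  have slope: "a < A - 2 * \<delta> * norm (x0 - y)"
    using R[OF x0(1)] \<delta> by (simp add: A_def mult.commute)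
  show thesis
  proof (rule that)
    have e: "\<phi> x0 = f x0"
      using \<phi>(2) eventually_nhds_x_imp_x by blast
    show "\<forall>\<^sub>F z in nhds x0. w z - \<phi> z \<le> w x0 - \<phi> x0"
      using \<phi>(2) eventually_nhds_in_open[OF V(1) \<open>x0 \<in> V\<close>]
      by eventually_elim (use x0(2) closure_subset e in auto)
    show "inf_laplacian \<phi> x0 < 0" "a < norm (grad \<phi> x0)"
      using slope a \<delta> by (auto simp: \<phi>)
  qed fact+
qed

lemma Ck_on_subset: "Ck_on k S f \<Longrightarrow> T \<subseteq> S \<Longrightarrow> Ck_on k T f"
  by (induction k arbitrary: f) (auto intro: continuous_on_subset)

lemma subsolution_below_cone:
  assumes \<Omega>: "open \<Omega>" "viscosity_subsolution \<Omega> u" "V \<subseteq> \<Omega>"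
    and V: "open V" "bounded V" "y \<notin> V" and u: "continuous_on (closure V) u" and a: "0 \<le> a"
    and bd: "\<And>x. x \<in> frontier V \<Longrightarrow> u x \<le> b + a * norm (x - y)"
    and p: "p \<in> V"
  shows "u p \<le> b + a * norm (p - y)"
proof (rule ccontr)
  assume "\<not> ?thesis"
  then have less: "b + a * norm (p - y) < u p" by simp
  obtain x0 \<phi> where *: "x0 \<in> V" "Ck_on 2 UNIV \<phi>" "\<forall>\<^sub>F z in nhds x0. u z - \<phi> z \<le> u x0 - \<phi> x0"
    "inf_laplacian \<phi> x0 < 0" "a < norm (grad \<phi> x0)"
    by (rule cone_touching[where w = u, OF V u a bd p less])
  have "Ck_on 2 \<Omega> \<phi>"
    using *(2) by (rule Ck_on_subset) simp
  moreover have "x0 \<in> \<Omega>" using *(1) \<Omega>(3) by blast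
  ultimately have "0 \<le> inf_laplacian \<phi> x0"
    using \<Omega>(2) *(3) unfolding viscosity_subsolution_iff[OF \<Omega>(1)] by blast
  with *(4) show False by simp
qed

lemma Ck_on_uminus:
  fixes \<phi> :: "real^'n \<Rightarrow> real"
  assumes S: "open S" and C: "Ck_on 2 S \<phi>"
  shows "Ck_on 2 S (\<lambda>x. - \<phi> x)" "x \<in> S \<Longrightarrow> grad (\<lambda>x. - \<phi> x) x = - grad \<phi> x"
    "x \<in> S \<Longrightarrow> inf_laplacian (\<lambda>x. - \<phi> x) x = - inf_laplacian \<phi> x"
  using C2_on_imp[OF S C2_on_uminus[OF Ck_on_imp_C2_on[OF S C]]]
  by (auto simp: inf_laplacian_def[of \<phi>] matrix_vector_mult_def vec_eq_iff sum_negf inner_vec_def)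

text \<open>The touching function has gradient norm strictly above \<open>a\<close>. This rules out
  the second alternative of the supersolution condition when \<open>1 \<le> a\<close>, and
  negativity of \<open>v\<close> rules it out otherwise; hence the hypothesis
  \<open>neg\<close>.\<close>

lemma supersolution_above_cone:
  assumes \<Omega>: "open \<Omega>" "viscosity_supersolution \<Omega> v" "V \<subseteq> \<Omega>"
    and V: "open V" "bounded V" "y \<notin> V" and v: "continuous_on (closure V) v" and a: "0 \<le> a"
    and neg: "1 \<le> a \<or> (\<forall>x\<in>V. v x < 0)"
    and bd: "\<And>x. x \<in> frontier V \<Longrightarrow> - v x \<le> b + a * norm (x - y)"
    and p: "p \<in> V"
  shows "- v p \<le> b + a * norm (p - y)"
proof (rule ccontr)
  assume "\<not> ?thesis"
  then have less: "b + a * norm (p - y) < - v p" by simp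
  have "continuous_on (closure V) (\<lambda>x. - v x)"
    using v by (intro continuous_intros)
  then obtain x0 \<phi> where *: "x0 \<in> V" "Ck_on 2 UNIV \<phi>"
    "\<forall>\<^sub>F z in nhds x0. - v z - \<phi> z \<le> - v x0 - \<phi> x0" "inf_laplacian \<phi> x0 < 0" "a < norm (grad \<phi> x0)"
    by (rule cone_touching[where w = "\<lambda>x. - v x", OF V _ a bd p less])
  have C: "Ck_on 2 \<Omega> \<phi>"
    using *(2) by (rule Ck_on_subset) simp
  have x0: "x0 \<in> \<Omega>" using *(1) \<Omega>(3) by blast
  have "\<forall>\<^sub>F z in nhds x0. v x0 - - \<phi> x0 \<le> v z - - \<phi> z"
    using *(3) by (rule eventually_mono) simp
  then have "inf_laplacian (\<lambda>x. - \<phi> x) x0 \<le> 0 \<or> 0 \<le> v x0 \<and> norm (grad (\<lambda>x. - \<phi> x) x0) \<le> 1"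
    using \<Omega>(2) x0 Ck_on_uminus(1)[OF \<Omega>(1) C] unfolding viscosity_supersolution_iff[OF \<Omega>(1)] by blast
  then have "- inf_laplacian \<phi> x0 \<le> 0 \<or> 0 \<le> v x0 \<and> norm (grad \<phi> x0) \<le> 1"
    using Ck_on_uminus(2,3)[OF \<Omega>(1) C x0] by simp
  with neg *(1,4,5) show False by force
qed

section \<open>Cones on balls and linear growth of subsolutions\<close>

lemma closure_punctured_ball_subset:
  fixes y :: "'a::euclidean_space"
  shows "closure (ball y r - {y}) \<subseteq> cball y r"
  by (rule closure_minimal) auto

lemma frontier_punctured_ball:
  fixes y :: "'a::euclidean_space"
  assumes "x \<in> frontier (ball y r - {y})"
  shows "x = y \<or> norm (x - y) = r"
  using assms closure_punctured_ball_subset[of y r]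
  by (auto simp: frontier_def interior_open open_delete dist_norm norm_minus_commute)

text \<open>Removing the vertex \<open>y\<close> from the ball turns it into a boundary point, where
  the cone equals \<open>u y\<close>; on the sphere the cone has the value \<open>M\<close>.\<close>

lemma subsolution_ball:
  assumes \<Omega>: "open \<Omega>" "viscosity_subsolution \<Omega> u" "continuous_on \<Omega> u"
    and r: "r > 0" "cball y r \<subseteq> \<Omega>" and M: "\<And>z. z \<in> cball y r \<Longrightarrow> u z \<le> M"
    and x: "x \<in> cball y r"
  shows "u x \<le> u y + (M - u y) / r * norm (x - y)"
proof (cases "x \<in> ball y r - {y}")
  case True
  show ?thesis
  proof (rule subsolution_below_cone[OF \<Omega>(1,2) _ _ _ _ _ _ _ True])
    show "ball y r - {y} \<subseteq> \<Omega>"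
      using r(2) ball_subset_cball by blast
    show "open (ball y r - {y})" "bounded (ball y r - {y})"
      by (auto intro: bounded_diff)
    show "continuous_on (closure (ball y r - {y})) u"
      using \<Omega>(3) closure_punctured_ball_subset r(2) by (meson continuous_on_subset order_trans)
    show "0 \<le> (M - u y) / r" using M[of y] r(1) by simp
    fix z assume "z \<in> frontier (ball y r - {y})"
    from frontier_punctured_ball[OF this]
    show "u z \<le> u y + (M - u y) / r * norm (z - y)"
      using M[of z] r(1) by (auto simp: dist_norm norm_minus_commute)
  qed auto
next
  case False
  then have "x = y \<or> norm (x - y) = r"
    using x by (auto simp: dist_norm norm_minus_commute)
  then show ?thesis
    using M[OF x] r(1) by auto
qed

text \<open>The slope is a parameter instead of being fitted to the maximum, because it may have to
  be raised to 1 where \<open>v\<close> is not negative.\<close>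

lemma supersolution_ball:
  assumes \<Omega>: "open \<Omega>" "viscosity_supersolution \<Omega> v" "continuous_on \<Omega> v"
    and r: "r > 0" "cball y r \<subseteq> \<Omega>" and a: "0 \<le> a" "1 \<le> a \<or> (\<forall>x\<in>cball y r. v x < 0)"
    and M: "\<And>z. z \<in> cball y r \<Longrightarrow> - v z \<le> - v y + a * r"
    and x: "x \<in> cball y r"
  shows "- v x \<le> - v y + a * norm (x - y)"
proof (cases "x \<in> ball y r - {y}")
  case True
  show ?thesis
  proof (rule supersolution_above_cone[OF \<Omega>(1,2) _ _ _ _ _ a(1) _ _ True])
    show "ball y r - {y} \<subseteq> \<Omega>"
      using r(2) ball_subset_cball by blast
    show "open (ball y r - {y})" "bounded (ball y r - {y})"
      by (auto intro: bounded_diff)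
    show "continuous_on (closure (ball y r - {y})) v"
      using \<Omega>(3) closure_punctured_ball_subset r(2) by (meson continuous_on_subset order_trans)
    show "1 \<le> a \<or> (\<forall>x\<in>ball y r - {y}. v x < 0)"
      using a(2) by auto
    fix z assume "z \<in> frontier (ball y r - {y})"
    from frontier_punctured_ball[OF this]
    show "- v z \<le> - v y + a * norm (z - y)"
      using M[of z] r(1) by (auto simp: dist_norm norm_minus_commute)
  qed auto
next
  case False
  then have "x = y \<or> norm (x - y) = r"
    using x by (auto simp: dist_norm norm_minus_commute)
  then show ?thesis
    using M[OF x] r(1) by auto
qed

text \<open>If \<open>u\<close> grew by less, a hyperboloid of slope below 1 would touch it from
  above at an interior point where \<open>u\<close> is still positive, against the gradient
  condition. Rounding the cone also covers the case that this point is the centre.\<close>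

lemma subsolution_growth:
  fixes u :: "real^'n \<Rightarrow> real"
  assumes \<Omega>: "open \<Omega>" "viscosity_subsolution \<Omega> u" "continuous_on \<Omega> u"
    and r: "r > 0" "cball x r \<subseteq> \<Omega>" and pos: "0 < u x"
  obtains z where "z \<in> cball x r" "u x + r \<le> u z"
proof (rule ccontr)
  assume "\<not> thesis"
  with that have lt: "u z < u x + r" if "z \<in> cball x r" for z
    using \<open>z \<in> cball x r\<close> by force
  have cont: "continuous_on (cball x r) u"
    using \<Omega>(3) r(2) by (rule continuous_on_subset)
  obtain z where z: "z \<in> cball x r" "\<And>y. y \<in> cball x r \<Longrightarrow> u y \<le> u z"
    using continuous_attains_sup[OF compact_cball _ cont] r(1) by auto
  define m where "m = u z - u x"
  have m: "0 \<le> m" "m < r" using z(2)[of x] lt[OF z(1)] r(1) by (auto simp: m_def)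
  \<comment> \<open>The midpoint of \<open>m / r\<close> and 1: a slope below 1 whose rise over the
    radius still exceeds \<open>m\<close>.\<close>
  define a where "a = (m / r + 1) / 2"
  have a: "0 < a" "a < 1" "m < a * r"
    using m r(1) by (auto simp: a_def field_simps)
  \<comment> \<open>The rounding lifts the centre to \<open>a * \<eta>\<close>; with half of the
    admissible amount the function still rises by more than \<open>m\<close> from the centre to the
    sphere, so the maximum below is not on the sphere.\<close>
  define \<eta> where "\<eta> = (r - m / a) / 2"
  have \<eta>: "0 < \<eta>" "m < a * (r - \<eta>)"
    using a by (auto simp: \<eta>_def field_simps)
  define q where "q = (\<lambda>y. (norm (y - x))\<^sup>2 + \<eta>\<^sup>2)"
  have q: "q y > 0" for y
    using \<eta>(1) by (simp add: q_def add_nonneg_pos)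
  define \<phi> where "\<phi> = (\<lambda>y. a * sqrt (q y))"
  have "continuous_on (cball x r) (\<lambda>y. u y - \<phi> y)"
    unfolding \<phi>_def q_def by (intro continuous_intros cont)
  then obtain x1 where x1: "x1 \<in> cball x r" "\<And>y. y \<in> cball x r \<Longrightarrow> u y - \<phi> y \<le> u x1 - \<phi> x1"
    using continuous_attains_sup[OF compact_cball, of x r "\<lambda>y. u y - \<phi> y"] r(1) by auto
  have \<phi>x: "\<phi> x = a * \<eta>"
    using \<eta>(1) by (simp add: \<phi>_def q_def)
  have le: "u x - a * \<eta> \<le> u x1 - \<phi> x1"
    using x1(2)[of x] r(1) by (simp add: \<phi>x)
  have "x1 \<in> ball x r"
  proof (rule ccontr)
    assume "x1 \<notin> ball x r"
    then have "norm (x1 - x) = r"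
      using x1(1) by (simp add: dist_norm norm_minus_commute)
    then have "a * r \<le> \<phi> x1"
      unfolding \<phi>_def q_def using a r(1) by (intro mult_left_mono real_le_rsqrt) auto
    then show False
      using le z(2)[OF x1(1)] \<eta>(2) by (simp add: m_def algebra_simps)
  qed
  \<comment> \<open>As \<open>\<phi>\<close> is smallest at the centre, maximality at
    \<open>x1\<close> gives \<open>u x \<le> u x1\<close>, so positivity carries over to
    \<open>x1\<close>.\<close>
  moreover have "\<eta> \<le> sqrt (q x1)"
    unfolding q_def by (rule real_le_rsqrt) simp
  then have "a * \<eta> \<le> \<phi> x1"
    unfolding \<phi>_def using a(1) by simp
  ultimately have pos1: "0 < u x1" and ball: "x1 \<in> ball x r"
    using le pos by auto
  define F where "F = (\<lambda>s. a * sqrt (s + \<eta>\<^sup>2))"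
  define F' where "F' = (\<lambda>s. a / (2 * sqrt (s + \<eta>\<^sup>2)))"
  define F'' where "F'' = (\<lambda>s. - a / (4 * sqrt (s + \<eta>\<^sup>2) * (s + \<eta>\<^sup>2)))"
  have dF: "(F has_real_derivative F' s) (at s)" if "s \<ge> 0" for s
  proof -
    have "s + \<eta>\<^sup>2 > 0" using that \<eta>(1) by (simp add: add_nonneg_pos)
    then show ?thesis
      unfolding F_def F'_def by (auto intro!: derivative_eq_intros simp: field_simps)
  qed
  have dF': "(F' has_real_derivative F'' s) (at s)" if "s \<ge> 0" for s
  proof -
    have p: "s + \<eta>\<^sup>2 > 0" using that \<eta>(1) by (simp add: add_nonneg_pos)
    have "((\<lambda>s. sqrt (s + \<eta>\<^sup>2)) has_real_derivative 1 / (2 * sqrt (s + \<eta>\<^sup>2))) (at s)"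
      using p by (auto intro!: derivative_eq_intros simp: field_simps)
    note D = DERIV_divide[OF DERIV_const[of a] DERIV_cmult[OF this, of 2]]
    have e: "(0 * (2 * \<rho>) - a * (2 * (1 / (2 * \<rho>)))) / (2 * \<rho> * (2 * \<rho>)) = - a / (4 * \<rho> * (\<rho> * \<rho>))"
      if "\<rho> > 0" for \<rho>
      using that by (simp add: field_simps)
    have r: "sqrt (s + \<eta>\<^sup>2) > 0" "sqrt (s + \<eta>\<^sup>2) * sqrt (s + \<eta>\<^sup>2) = s + \<eta>\<^sup>2" using p by auto
    show ?thesis
      unfolding F'_def F''_def using D e[OF r(1)] r by (simp only: r(2))
  qed
  have cF: "continuous_on UNIV (\<lambda>y. F'' ((norm (y - x))\<^sup>2))"
    unfolding F''_def using q by (intro continuous_intros) (auto simp: q_def less_le)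
  have \<phi>F: "(\<lambda>y. F ((norm (y - x))\<^sup>2)) = \<phi>"
    by (simp add: F_def \<phi>_def q_def)
  note C2 = C2_on_radial[where S = UNIV and y = x, OF dF[OF zero_le_power2] dF'[OF zero_le_power2] cF, unfolded \<phi>F]
  have "Ck_on 2 \<Omega> \<phi>"
    using Ck_on_subset[OF C2_on_imp(1)[OF open_UNIV C2]] by simp
  moreover have "\<forall>\<^sub>F y in nhds x1. u y - \<phi> y \<le> u x1 - \<phi> x1"
    using eventually_nhds_in_open[OF open_ball ball] by (rule eventually_mono) (use x1 in auto)
  ultimately have "1 \<le> norm (grad \<phi> x1)"
    using \<Omega>(2) x1(1) r(2) pos1 unfolding viscosity_subsolution_iff[OF \<Omega>(1)] by blast
  also have "norm (grad \<phi> x1) = a * (norm (x1 - x) / sqrt (q x1))"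
    using C2_on_imp(2)[OF open_UNIV C2, of x1] a q[of x1] by (simp add: F'_def q_def abs_mult)
  also have "\<dots> \<le> a * 1"
  proof (rule mult_left_mono)
    have "norm (x1 - x) \<le> sqrt (q x1)"
      unfolding q_def by (rule real_le_rsqrt) simp
    then show "norm (x1 - x) / sqrt (q x1) \<le> 1"
      using q[of x1] by simp
  qed (use a in simp)
  finally show False using a by simp
qed

section \<open>The comparison principle\<close>

definition supball :: "real \<Rightarrow> ('a::metric_space \<Rightarrow> real) \<Rightarrow> 'a \<Rightarrow> real" where
  "supball \<epsilon> w x = Sup (w ` cball x \<epsilon>)"

lemma supball_attained:
  fixes x :: "'a::heine_borel"
  assumes "0 \<le> \<epsilon>" "continuous_on (cball x \<epsilon>) w"
  obtains y where "y \<in> cball x \<epsilon>" "supball \<epsilon> w x = w y" "\<And>z. z \<in> cball x \<epsilon> \<Longrightarrow> w z \<le> w y"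
proof -
  obtain y where y: "y \<in> cball x \<epsilon>" "\<And>z. z \<in> cball x \<epsilon> \<Longrightarrow> w z \<le> w y"
    using continuous_attains_sup[OF compact_cball _ assms(2)] assms(1) by auto
  then have "supball \<epsilon> w x = w y"
    unfolding supball_def by (intro cSup_eq_maximum) auto
  with y show thesis using that by blast
qed

lemma le_supball:
  fixes x :: "'a::heine_borel"
  assumes "continuous_on (cball x \<epsilon>) w" "y \<in> cball x \<epsilon>"
  shows "w y \<le> supball \<epsilon> w x"
proof -
  have "0 \<le> \<epsilon>" using assms(2) zero_le_dist[of x y] by (simp del: zero_le_dist)
  then show ?thesis
    using supball_attained[OF _ assms(1)] assms(2) by metis
qed

text \<open>Translating by \<open>b - a\<close> carries a maximizer in one ball into the other ball,
  so the supremum inherits the modulus of continuity of \<open>w\<close> on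
  \<open>K\<close>.\<close>

lemma supball_continuous_on:
  fixes w :: "'a::euclidean_space \<Rightarrow> real"
  assumes K: "compact K" "continuous_on K w" and \<epsilon>: "0 \<le> \<epsilon>" and X: "\<And>x. x \<in> X \<Longrightarrow> cball x \<epsilon> \<subseteq> K"
  shows "continuous_on X (supball \<epsilon> w)"
  unfolding continuous_on_iff
proof (intro ballI allI impI)
  fix x \<eta> :: "_" assume x: "x \<in> X" and "(0::real) < \<eta>"
  then obtain d where d: "d > 0" "\<And>y z. y \<in> K \<Longrightarrow> z \<in> K \<Longrightarrow> dist z y < d \<Longrightarrow> dist (w z) (w y) < \<eta>"
    using compact_uniformly_continuous[OF K(2,1)] unfolding uniformly_continuous_on_def by metis
  have le: "supball \<epsilon> w a < supball \<epsilon> w b + \<eta>" if ab: "a \<in> X" "b \<in> X" "dist a b < d" for a b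
  proof -
    have c: "continuous_on (cball a \<epsilon>) w" "continuous_on (cball b \<epsilon>) w"
      using K(2) X ab continuous_on_subset by blast+
    obtain y where y: "y \<in> cball a \<epsilon>" "supball \<epsilon> w a = w y"
      using supball_attained[OF \<epsilon> c(1)] by blast
    define z where "z = y + (b - a)"
    have z: "z \<in> cball b \<epsilon>"
      using y(1) by (simp add: z_def dist_norm algebra_simps)
    have "y \<in> K" "z \<in> K"
      using X ab(1,2) y(1) z by blast+
    then have "dist (w z) (w y) < \<eta>"
      using ab(3) by (intro d) (auto simp: z_def dist_norm norm_minus_commute)
    moreover have "w z \<le> supball \<epsilon> w b"
      by (rule le_supball[OF c(2) z])
    ultimately show ?thesis
      unfolding y(2) dist_real_def by linarith
  qed
  have "dist (supball \<epsilon> w x') (supball \<epsilon> w x) < \<eta>" if "x' \<in> X" "dist x' x < d" for x'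
    using le[of x x'] le[of x' x] that x by (auto simp: dist_real_def dist_commute)
  with d(1) show "\<exists>d>0. \<forall>x'\<in>X. dist x' x < d \<longrightarrow> dist (supball \<epsilon> w x') (supball \<epsilon> w x) < \<eta>"
    by blast
qed

lemma compact_level_set:
  fixes f :: "'a::topological_space \<Rightarrow> 'b::t1_space"
  assumes "compact X" "continuous_on X f"
  shows "compact {z \<in> X. f z = c}"
  by (rule closedin_compact[OF assms(1) continuous_closedin_preimage_constant[OF assms(2)]])

lemma lexicographic_max:
  fixes f g h :: "'a::topological_space \<Rightarrow> real"
  assumes X: "compact X" "X \<noteq> {}"
    and c: "continuous_on X f" "continuous_on X g" "continuous_on X h"
  obtains x where "x \<in> X" "\<And>z. z \<in> X \<Longrightarrow> f z \<le> f x"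
    "\<And>z. z \<in> X \<Longrightarrow> f z = f x \<Longrightarrow> g z \<le> g x"
    "\<And>z. z \<in> X \<Longrightarrow> f z = f x \<Longrightarrow> g z = g x \<Longrightarrow> h z \<le> h x"
proof -
  obtain a where a: "a \<in> X" "\<And>z. z \<in> X \<Longrightarrow> f z \<le> f a"
    using continuous_attains_sup[OF X c(1)] by blast
  define E where "E = {z \<in> X. f z = f a}"
  have E: "compact E" "E \<subseteq> X" "a \<in> E"
    using compact_level_set[OF X(1) c(1)] a by (auto simp: E_def)
  obtain b where b: "b \<in> E" "\<And>z. z \<in> E \<Longrightarrow> g z \<le> g b"
    using continuous_attains_sup[OF E(1) _ continuous_on_subset[OF c(2) E(2)]] E(3) by blast
  define F where "F = {z \<in> E. g z = g b}"
  have F: "compact F" "F \<subseteq> X" "b \<in> F"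
    using compact_level_set[OF E(1) continuous_on_subset[OF c(2) E(2)]] b E(2) by (auto simp: F_def)
  obtain x where x: "x \<in> F" "\<And>z. z \<in> F \<Longrightarrow> h z \<le> h x"
    using continuous_attains_sup[OF F(1) _ continuous_on_subset[OF c(3) F(2)]] F(3) by blast
  show thesis
    by (rule that[of x]) (use a b x in \<open>auto simp: E_def F_def\<close>)
qed

lemma frontier_point_near:
  fixes x y :: "'a::euclidean_space"
  assumes "x \<in> S" "y \<notin> S"
  obtains c where "c \<in> frontier S" "dist x c \<le> dist x y"
proof -
  have "closed_segment x y \<inter> frontier S \<noteq> {}"
    using assms by (intro connected_Int_frontier) auto
  then obtain c where "c \<in> closed_segment x y" "c \<in> frontier S" by blast
  then show thesis
    using that segment_bound(1)[of c x y] by (simp add: dist_norm norm_minus_commute)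
qed

section \<open>Discrete inequalities on balls\<close>

lemma supball_double:
  fixes w :: "'a::euclidean_space \<Rightarrow> real"
  assumes "0 \<le> \<epsilon>" and w: "continuous_on (cball x (2 * \<epsilon>)) w"
  obtains z where "z \<in> cball x \<epsilon>" "supball (2 * \<epsilon>) w x \<le> supball \<epsilon> w z"
proof -
  obtain y where y: "y \<in> cball x (2 * \<epsilon>)" "supball (2 * \<epsilon>) w x = w y"
    using supball_attained[OF _ w] assms(1) by auto
  define z where "z = midpoint x y"
  have z: "z \<in> cball x \<epsilon>" "y \<in> cball z \<epsilon>"
    using y(1) by (auto simp: z_def dist_midpoint)
  have "cball z \<epsilon> \<subseteq> cball x (2 * \<epsilon>)"
    using z(1) by (simp add: cball_subset_cball_iff dist_commute)
  then have "w y \<le> supball \<epsilon> w z"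
    using z(2) by (intro le_supball continuous_on_subset[OF w])
  with z(1) y(2) show thesis by (intro that) auto
qed

text \<open>At half the radius of the large ball the cone has covered at most half of its rise. For
  the second claim growth is applied at the maximizer in the small ball and not at \<open>x\<close>,
  so positivity of the supremum is enough.\<close>

lemma subsolution_supball:
  fixes u :: "real^'n \<Rightarrow> real"
  assumes \<Omega>: "open \<Omega>" "viscosity_subsolution \<Omega> u" "continuous_on \<Omega> u"
    and \<epsilon>: "0 < \<epsilon>" "cball x (2 * \<epsilon>) \<subseteq> \<Omega>"
  shows "2 * supball \<epsilon> u x \<le> u x + supball (2 * \<epsilon>) u x"
    and "0 < supball \<epsilon> u x \<Longrightarrow> supball \<epsilon> u x + \<epsilon> \<le> supball (2 * \<epsilon>) u x"
proof -
  have sub: "cball x \<epsilon> \<subseteq> cball x (2 * \<epsilon>)" using \<epsilon>(1) by auto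
  have c2: "continuous_on (cball x (2 * \<epsilon>)) u" and c1: "continuous_on (cball x \<epsilon>) u"
    using \<Omega>(3) \<epsilon>(2) sub by (meson continuous_on_subset)+
  obtain y where y: "y \<in> cball x \<epsilon>" "supball \<epsilon> u x = u y"
    using supball_attained[OF _ c1] \<epsilon>(1) by (metis less_imp_le)
  define m where "m = supball (2 * \<epsilon>) u x - u x"
  have m: "0 \<le> m" using le_supball[OF c2, of x] \<epsilon>(1) by (simp add: m_def)
  have "u y \<le> u x + m / (2 * \<epsilon>) * norm (y - x)"
    unfolding m_def using y(1) sub \<epsilon> le_supball[OF c2] by (intro subsolution_ball[OF \<Omega>]) auto
  also have "\<dots> \<le> u x + m / (2 * \<epsilon>) * \<epsilon>"
    using y(1) \<epsilon>(1) m by (intro add_left_mono mult_left_mono) (auto simp: dist_norm norm_minus_commute)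
  also have "\<dots> = u x + m / 2" using \<epsilon>(1) by simp
  finally show "2 * supball \<epsilon> u x \<le> u x + supball (2 * \<epsilon>) u x"
    unfolding y(2) by (simp add: m_def field_simps)
  assume "0 < supball \<epsilon> u x"
  then have pos: "0 < u y" by (simp add: y(2))
  have yy: "cball y \<epsilon> \<subseteq> cball x (2 * \<epsilon>)"
    using y(1) by (simp add: cball_subset_cball_iff dist_commute)
  obtain z where "z \<in> cball y \<epsilon>" "u y + \<epsilon> \<le> u z"
    by (rule subsolution_growth[OF \<Omega> \<epsilon>(1) order_trans[OF yy \<epsilon>(2)] pos])
  then show "supball \<epsilon> u x + \<epsilon> \<le> supball (2 * \<epsilon>) u x"
    using le_supball[OF c2, of z] yy y(2) by auto
qed

lemma supersolution_supball:
  fixes v :: "real^'n \<Rightarrow> real"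
  assumes \<Omega>: "open \<Omega>" "viscosity_supersolution \<Omega> v" "continuous_on \<Omega> v"
    and \<epsilon>: "0 < \<epsilon>" "cball x (2 * \<epsilon>) \<subseteq> \<Omega>"
  defines "q \<equiv> \<lambda>r. supball r (\<lambda>z. - v z) x"
  shows "2 * q \<epsilon> \<le> - v x + q (2 * \<epsilon>) \<or> q \<epsilon> \<le> - v x + \<epsilon> \<and> (\<exists>z\<in>cball x (2 * \<epsilon>). 0 \<le> v z)"
proof -
  have sub: "cball x \<epsilon> \<subseteq> cball x (2 * \<epsilon>)" using \<epsilon>(1) by auto
  have c: "continuous_on \<Omega> (\<lambda>z. - v z)" using \<Omega>(3) by (intro continuous_intros)
  have c2: "continuous_on (cball x (2 * \<epsilon>)) (\<lambda>z. - v z)" and c1: "continuous_on (cball x \<epsilon>) (\<lambda>z. - v z)"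
    using c \<epsilon>(2) sub by (meson continuous_on_subset)+
  obtain y where y: "y \<in> cball x \<epsilon>" "q \<epsilon> = - v y"
    using supball_attained[OF _ c1] \<epsilon>(1) unfolding q_def by (metis less_imp_le)
  have yx: "norm (y - x) \<le> \<epsilon>" using y(1) by (simp add: dist_norm norm_minus_commute)
  define a where "a = (q (2 * \<epsilon>) + v x) / (2 * \<epsilon>)"
  have q2: "- v z \<le> q (2 * \<epsilon>)" if "z \<in> cball x (2 * \<epsilon>)" for z
    unfolding q_def using le_supball[OF c2 that] by simp
  have a0: "0 \<le> a" using q2[of x] \<epsilon>(1) by (simp add: a_def)
  have a2: "q (2 * \<epsilon>) = - v x + a * (2 * \<epsilon>)"
    using \<epsilon>(1) by (simp add: a_def)
  show ?thesis
  proof (cases "1 \<le> a \<or> (\<forall>z\<in>cball x (2 * \<epsilon>). v z < 0)")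
    case True
    have "- v y \<le> - v x + a * norm (y - x)"
      using True a0 a2 q2 y(1) sub \<epsilon> by (intro supersolution_ball[OF \<Omega>, of "2 * \<epsilon>"]) auto
    also have "a * norm (y - x) \<le> a * \<epsilon>"
      using yx a0 by (rule mult_left_mono)
    finally show ?thesis
      using a2 y(2) by simp
  next
    case False
    \<comment> \<open>Now \<open>a < 1\<close>, so the slope is raised to 1, which is admissible
      whatever the sign of \<open>v\<close>; at distance at most \<epsilon> from \<open>x\<close>
      the cone then rises by at most \<epsilon>.\<close>
    have "a * (2 * \<epsilon>) \<le> 1 * (2 * \<epsilon>)"
      using False \<epsilon>(1) by (intro mult_right_mono) auto
    then have "- v z \<le> - v x + 1 * (2 * \<epsilon>)" if "z \<in> cball x (2 * \<epsilon>)" for z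
      using q2[OF that] a2 by linarith
    then have "- v y \<le> - v x + 1 * norm (y - x)"
      using y(1) sub \<epsilon> by (intro supersolution_ball[OF \<Omega>, of "2 * \<epsilon>"]) auto
    then show ?thesis
      using yx y(2) False by (auto simp: not_less)
  qed
qed

theorem comparison:
  fixes u v :: "real^'n \<Rightarrow> real"
  assumes \<Omega>: "open \<Omega>" "bounded \<Omega>"
    and u: "viscosity_subsolution \<Omega> u" "continuous_on (closure \<Omega>) u"
    and v: "viscosity_supersolution \<Omega> v" "continuous_on (closure \<Omega>) v"
    and bd: "\<And>x. x \<in> frontier \<Omega> \<Longrightarrow> u x \<le> v x"
    and x: "x \<in> \<Omega>"
  shows "u x \<le> v x"
proof (rule ccontr)
  assume n: "\<not> u x \<le> v x"
  define K where "K = closure \<Omega>"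
  have K: "compact K" "\<Omega> \<subseteq> K" "x \<in> K" "frontier \<Omega> \<subseteq> K"
    using \<Omega>(2) closure_subset x by (auto simp: K_def frontier_def)
  have uK: "continuous_on K u" and vK: "continuous_on K (\<lambda>z. - v z)"
    using u v by (auto simp: K_def intro: continuous_intros)
  have cu: "continuous_on \<Omega> u" and cv: "continuous_on \<Omega> v"
    using u(2) v(2) closure_subset continuous_on_subset by blast+
  obtain xm where xm: "xm \<in> K" "\<And>z. z \<in> K \<Longrightarrow> u z + - v z \<le> u xm + - v xm"
    using continuous_attains_sup[OF K(1) _ continuous_on_add[OF uK vK]] K(3) by blast
  define m where "m = u xm - v xm"
  have m: "m > 0" using xm(2)[OF K(3)] n by (simp add: m_def)
  obtain d1 where d1: "d1 > 0" "\<And>y z. y \<in> K \<Longrightarrow> z \<in> K \<Longrightarrow> dist z y < d1 \<Longrightarrow> dist (u z) (u y) < m / 8"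
    using compact_uniformly_continuous[OF uK K(1)] m unfolding uniformly_continuous_on_def
    by (metis zero_less_divide_iff zero_less_numeral)
  obtain d2 where d2: "d2 > 0" "\<And>y z. y \<in> K \<Longrightarrow> z \<in> K \<Longrightarrow> dist z y < d2 \<Longrightarrow> dist (- v z) (- v y) < m / 8"
    using compact_uniformly_continuous[OF vK K(1)] m unfolding uniformly_continuous_on_def
    by (metis zero_less_divide_iff zero_less_numeral)
  \<comment> \<open>5 \<epsilon> must stay below both moduli: in \<open>near\<close> a point is
    reached from the frontier by a step of 4 \<epsilon> and one of \<epsilon>. There two errors of m
    / 8 are added to a nonpositive value; near the end one such error still leaves
    \<open>p a\<close> positive.\<close>
  define \<epsilon> where "\<epsilon> = min d1 d2 / 6"
  have \<epsilon>: "\<epsilon> > 0" "5 * \<epsilon> < d1" "5 * \<epsilon> < d2"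
    using d1(1) d2(1) by (auto simp: \<epsilon>_def)
  have mod: "u z < u y + m / 8" "- v z < - v y + m / 8" if "y \<in> K" "z \<in> K" "dist z y \<le> 5 * \<epsilon>" for y z
  proof -
    have "dist (u z) (u y) < m / 8" "dist (- v z) (- v y) < m / 8"
      using that \<epsilon> by (intro d1(2) d2(2); simp)+
    then show "u z < u y + m / 8" "- v z < - v y + m / 8"
      unfolding dist_real_def by linarith+
  qed
  have near: "u y + - v z < m" if ab: "a \<in> \<Omega>" "b \<notin> \<Omega>" and "dist a b \<le> 4 * \<epsilon>"
    "y \<in> K" "z \<in> K" "dist a y \<le> \<epsilon>" "dist a z \<le> \<epsilon>" for a b y z
  proof -
    obtain c where c: "c \<in> frontier \<Omega>" "dist a c \<le> dist a b"
      by (rule frontier_point_near[OF ab])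
    have "dist y c \<le> 5 * \<epsilon>" "dist z c \<le> 5 * \<epsilon>"
      using that ab c(2) dist_triangle3[of y c a] dist_triangle3[of z c a] by linarith+
    moreover have "c \<in> K" using c(1) K(4) by blast
    ultimately have "u y < u c + m / 8" "- v z < - v c + m / 8"
      using that(4,5) by (intro mod; simp)+
    then show ?thesis
      using bd[OF c(1)] m by simp
  qed
  \<comment> \<open>The margin 2 \<epsilon> keeps \<epsilon>-balls inside \<open>\<Omega>\<close>.
    By \<open>far\<close>, a maximizer of p + q is more than 4 \<epsilon> from the complement, so
    all points within \<epsilon> of it belong to \<open>X\<close> again and compete with it.\<close>
  define X where "X = {a. \<forall>b\<in>-\<Omega>. 2 * \<epsilon> \<le> dist a b}"
  have X\<Omega>: "X \<subseteq> \<Omega>"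
    using \<epsilon>(1) by (force simp: X_def)
  have "X = (\<Inter>b\<in>-\<Omega>. {a. 2 * \<epsilon> \<le> dist a b})"
    by (auto simp: X_def)
  then have "closed X"
    by (auto intro!: closed_INT closed_Collect_le continuous_intros)
  moreover have "bounded X"
    using \<Omega>(2) X\<Omega> bounded_subset by blast
  ultimately have X: "compact X"
    by (simp add: compact_eq_bounded_closed)
  have cballX: "cball a \<epsilon> \<subseteq> \<Omega>" if "a \<in> X" for a
    using that \<epsilon>(1) by (force simp: X_def)
  define p where "p = supball \<epsilon> u"
  define q where "q = supball \<epsilon> (\<lambda>z. - v z)"
  have cp: "continuous_on X p" and cq: "continuous_on X q"
    unfolding p_def q_def using K cballX uK vK \<epsilon>(1) by (auto intro!: supball_continuous_on[of K])
  have ucb: "continuous_on (cball a r) u" and vcb: "continuous_on (cball a r) (\<lambda>z. - v z)"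
    if "cball a r \<subseteq> \<Omega>" for a r
    using that uK vK K(2) by (meson continuous_on_subset)+
  have far: "4 * \<epsilon> < dist a b" if a: "a \<in> X" "m \<le> p a + q a" and b: "b \<notin> \<Omega>" for a b
  proof (rule ccontr)
    assume f: "\<not> 4 * \<epsilon> < dist a b"
    obtain y where y: "y \<in> cball a \<epsilon>" "p a = u y"
      using supball_attained[OF _ ucb[OF cballX[OF a(1)]]] \<epsilon>(1) unfolding p_def by (metis less_imp_le)
    obtain z where z: "z \<in> cball a \<epsilon>" "q a = - v z"
      using supball_attained[OF _ vcb[OF cballX[OF a(1)]]] \<epsilon>(1) unfolding q_def by (metis less_imp_le)
    have "u y + - v z < m"
      using a(1) b f X\<Omega> y(1) z(1) cballX[OF a(1)] K(2) by (intro near[of a b]) auto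
    then show False using a(2) y(2) z(2) by simp
  qed
  have "xm \<notin> frontier \<Omega>"
    using bd[of xm] m by (auto simp: m_def)
  then have xm\<Omega>: "xm \<in> \<Omega>"
    using xm(1) \<Omega>(1) by (auto simp: K_def frontier_def interior_open)
  have "2 * \<epsilon> \<le> dist xm b" if "b \<notin> \<Omega>" for b
  proof (rule ccontr)
    assume "\<not> 2 * \<epsilon> \<le> dist xm b"
    then have "u xm + - v xm < m"
      using that xm\<Omega> xm(1) \<epsilon>(1) by (intro near[of xm b]) auto
    then show False by (simp add: m_def)
  qed
  then have xmX: "xm \<in> X"
    by (simp add: X_def)
  have pqm: "m \<le> p xm + q xm"
    using le_supball[OF ucb[OF cballX[OF xmX]], of xm] le_supball[OF vcb[OF cballX[OF xmX]], of xm] \<epsilon>(1)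
    unfolding p_def q_def m_def by simp
  \<comment> \<open>An arbitrary coordinate direction; any unit vector serves to break the last
    tie.\<close>
  define e :: "real^'n" where "e = axis undefined 1"
  have e: "norm e = 1" "e \<bullet> e = 1" by (auto simp: e_def inner_axis_axis)
  obtain a where a: "a \<in> X" "\<And>z. z \<in> X \<Longrightarrow> p z + q z \<le> p a + q a"
    "\<And>z. z \<in> X \<Longrightarrow> p z + q z = p a + q a \<Longrightarrow> p z \<le> p a"
    "\<And>z. z \<in> X \<Longrightarrow> p z + q z = p a + q a \<Longrightarrow> p z = p a \<Longrightarrow> z \<bullet> e \<le> a \<bullet> e"
    by (rule lexicographic_max[of X "\<lambda>z. p z + q z" p "\<lambda>z. z \<bullet> e"])
      (use X xmX cp cq in \<open>auto intro!: continuous_intros\<close>)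
  have am: "m \<le> p a + q a" using pqm a(2)[OF xmX] by simp
  note far_a = far[OF a(1) am]
  have aX: "cball a \<epsilon> \<subseteq> X"
  proof
    fix z assume z: "z \<in> cball a \<epsilon>"
    have "2 * \<epsilon> \<le> dist z b" if "b \<notin> \<Omega>" for b
      using z far_a[OF that] \<epsilon>(1) dist_triangle[of a b z] by simp
    then show "z \<in> X"
      by (simp add: X_def)
  qed
  have ball2: "cball a (2 * \<epsilon>) \<subseteq> \<Omega>"
    using far_a \<epsilon>(1) by force
  define P where "P = supball (2 * \<epsilon>) u a"
  define Q where "Q = supball (2 * \<epsilon>) (\<lambda>z. - v z) a"
  \<comment> \<open>Doubled balls are reached through neighbours: \<open>P\<close> and
    \<open>Q\<close> are bounded by values of \<open>p\<close> and \<open>q\<close> within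
    \<epsilon> of \<open>a\<close>, where maximality of p + q can be applied.\<close>
  obtain z1 where z1: "z1 \<in> cball a \<epsilon>" "P \<le> p z1"
    using supball_double[OF _ ucb[OF ball2]] \<epsilon>(1) unfolding P_def p_def by (metis less_imp_le)
  obtain z2 where z2: "z2 \<in> cball a \<epsilon>" "Q \<le> q z2"
    using supball_double[OF _ vcb[OF ball2]] \<epsilon>(1) unfolding Q_def q_def by (metis less_imp_le)
  have pl: "u a \<le> p z" and ql: "- v a \<le> q z" if "z \<in> cball a \<epsilon>" for z
    unfolding p_def q_def using that aX cballX[of z] le_supball[OF ucb, of z \<epsilon> a] le_supball[OF vcb, of z \<epsilon> a]
    by (auto simp: dist_commute)
  have pP: "p z \<le> P" and qQ: "q z \<le> Q" if z: "z \<in> cball a \<epsilon>" for z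
  proof -
    have s: "cball z \<epsilon> \<subseteq> cball a (2 * \<epsilon>)"
      using z by (simp add: cball_subset_cball_iff dist_commute)
    have zX: "cball z \<epsilon> \<subseteq> \<Omega>" using z aX cballX by blast
    show "p z \<le> P"
      using supball_attained[OF _ ucb[OF zX]] le_supball[OF ucb[OF ball2]] s \<epsilon>(1)
      unfolding p_def P_def by (metis less_imp_le subsetD)
    show "q z \<le> Q"
      using supball_attained[OF _ vcb[OF zX]] le_supball[OF vcb[OF ball2]] s \<epsilon>(1)
      unfolding q_def Q_def by (metis less_imp_le subsetD)
  qed
  have i1: "p z1 + q z1 \<le> p a + q a" and i2: "p z2 + q z2 \<le> p a + q a"
    using a(2) z1(1) z2(1) aX by auto
  have S1: "2 * p a \<le> u a + P" and S2: "0 < p a \<Longrightarrow> p a + \<epsilon> \<le> P"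
    using subsolution_supball[OF \<Omega>(1) u(1) cu \<epsilon>(1) ball2] unfolding p_def P_def by auto
  from supersolution_supball[OF \<Omega>(1) v(1) cv \<epsilon>(1) ball2, folded q_def Q_def]
  show False
  proof
    assume T: "2 * q a \<le> - v a + Q"
    \<comment> \<open>The sum of \<open>T\<close> and \<open>S1\<close> and the sum of
      \<open>i1\<close> and \<open>i2\<close> bound \<open>2 * (p a + q a)\<close> by
      \<open>u a - v a + P + Q\<close> from opposite sides, so every inequality involved is an
      equality.\<close>
    have "p z1 + q z1 = p a + q a"
      using T S1 i1 i2 pl[OF z2(1)] ql[OF z1(1)] z1(2) z2(2) by linarith
    then have "p z1 \<le> p a"
      using a(3) z1(1) aX by auto
    then have eq: "u a = p a" "P = p a" "Q = q a" "- v a = q a"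
      using T S1 i1 i2 pl[OF z2(1)] ql[OF z1(1)] z1(2) z2(2) pP[of a] \<epsilon>(1) by auto
    \<comment> \<open>By \<open>eq\<close>, \<open>p\<close> lies between \<open>u a\<close> and
      \<open>P = u a\<close> on the ball, and likewise \<open>q\<close>. Both are constant there, so
      moving in direction \<open>e\<close> increases the linear functional without losing
      anything.\<close>
    define z where "z = a + \<epsilon> *\<^sub>R e"
    have z: "z \<in> cball a \<epsilon>"
      using e \<epsilon>(1) by (simp add: z_def dist_norm)
    have "p z = p a" "q z = q a"
      using pl[OF z] ql[OF z] pP[OF z] qQ[OF z] eq by auto
    then have "z \<bullet> e \<le> a \<bullet> e"
      using a(4) z aX by auto
    then show False
      using e \<epsilon>(1) by (simp add: z_def inner_add_left)
  next
    assume "q a \<le> - v a + \<epsilon> \<and> (\<exists>z\<in>cball a (2 * \<epsilon>). 0 \<le> v z)"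
    then obtain w where w: "w \<in> cball a (2 * \<epsilon>)" "0 \<le> v w" and T: "q a \<le> - v a + \<epsilon>" by blast
    obtain y where y: "y \<in> cball a \<epsilon>" "q a = - v y"
      using supball_attained[OF _ vcb[OF cballX[OF a(1)]]] \<epsilon>(1) unfolding q_def by (metis less_imp_le)
    have "dist y w \<le> 5 * \<epsilon>"
      using y(1) w(1) dist_triangle3[of y w a] \<epsilon>(1) by simp
    then have "q a < m / 8"
      using mod(2)[of w y] w y ball2 K(2) cballX[OF a(1)] by force
    then have "p a > 0" using am m by linarith
    then have "P \<ge> p a + \<epsilon>" by (rule S2)
    \<comment> \<open>Passing from \<open>a\<close> to \<open>z1\<close>, \<open>p\<close> gains at
      least \<epsilon> and \<open>q\<close> loses at most \<epsilon>; so \<open>z1\<close> also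
      maximizes p + q, but with a larger \<open>p\<close>.\<close>
    then have "p z1 + q z1 = p a + q a" "p z1 \<ge> p a + \<epsilon>"
      using T i1 z1(2) ql[OF z1(1)] by linarith+
    then show False
      using a(3)[of z1] z1(1) aX \<epsilon>(1) by auto
  qed
qed

section \<open>Perron's method\<close>

text \<open>Lets a C2 function that satisfies an inequality pointwise pass it on to every test
  function touching it from above: gradients agree and second derivatives are ordered along the
  gradient.\<close>

lemma touching_compare:
  assumes S: "open S" "x \<in> S" and C: "Ck_on 2 S \<theta>" "Ck_on 2 S \<phi>"
    and m: "\<forall>\<^sub>F z in nhds x. \<theta> x - \<phi> x \<le> \<theta> z - \<phi> z"
  shows "grad \<theta> x = grad \<phi> x" "inf_laplacian \<phi> x \<le> inf_laplacian \<theta> x"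
proof -
  note C2 = C2_on_add[OF Ck_on_imp_C2_on[OF S(1) C(1)] C2_on_uminus[OF Ck_on_imp_C2_on[OF S(1) C(2)]]]
  have m': "\<forall>\<^sub>F z in nhds x. \<theta> x + - \<phi> x \<le> \<theta> z + - \<phi> z"
    using m by simp
  show g: "grad \<theta> x = grad \<phi> x"
    using local_min_C2(1)[OF S C2 m'] by simp
  show "inf_laplacian \<phi> x \<le> inf_laplacian \<theta> x"
    using local_min_C2(2)[OF S C2 m', of "grad \<phi> x"]
    by (simp add: inf_laplacian_def g inner_diff_right)
qed

text \<open>Away from its vertex the cone is smooth, with zero infinity Laplacian and gradient norm
  \<open>L\<close>. Where the cone is positive the gradient condition demands
  \<open>1 \<le> L\<close>.\<close>

lemma subsolution_cone:
  fixes z :: "real^'n"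
  assumes \<Omega>: "open \<Omega>" "z \<notin> \<Omega>" and L: "1 \<le> L"
  shows "viscosity_subsolution \<Omega> (\<lambda>x. b - L * norm (x - z))"
  unfolding viscosity_subsolution_iff[OF \<Omega>(1)]
proof (intro conjI[OF continuous_on_imp_semicontinuous(1)] ballI allI impI)
  show "continuous_on \<Omega> (\<lambda>x. b - L * norm (x - z))"
    by (intro continuous_intros)
next
  fix x \<theta> assume x: "x \<in> \<Omega>" and C: "Ck_on 2 \<Omega> \<theta>"
    and m: "\<forall>\<^sub>F y in nhds x. b - L * norm (y - z) - \<theta> y \<le> b - L * norm (x - z) - \<theta> x"
  have "x \<noteq> z" using x \<Omega>(2) by blast
  then obtain \<phi> where \<phi>: "Ck_on 2 UNIV \<phi>"
    "\<forall>\<^sub>F y in nhds x. \<phi> y = b + - L * norm (y - z) - 0 * (norm (y - z))\<^sup>2"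
    "norm (grad \<phi> x) = \<bar>- L - 2 * 0 * norm (x - z)\<bar>"
    "inf_laplacian \<phi> x = - 2 * 0 * (- L - 2 * 0 * norm (x - z))\<^sup>2"
    by (rule smooth_cone)
  have "\<phi> x = b - L * norm (x - z)"
    using eventually_nhds_x_imp_x[OF \<phi>(2)] by simp
  with m \<phi>(2) have "\<forall>\<^sub>F y in nhds x. \<theta> x - \<phi> x \<le> \<theta> y - \<phi> y"
    by (auto elim: eventually_elim2)
  note t = touching_compare[OF \<Omega>(1) x C Ck_on_subset[OF \<phi>(1) subset_UNIV] this]
  show "0 \<le> inf_laplacian \<theta> x \<and> (0 < b - L * norm (x - z) \<longrightarrow> 1 \<le> norm (grad \<theta> x))"
    using t \<phi>(3,4) L by simp
qed

section \<open>Suprema of subsolutions and the Perron bump\<close>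

lemma eventually_nhds_cball:
  fixes x :: "'a::metric_space"
  assumes "\<forall>\<^sub>F y in nhds x. P y"
  obtains r where "0 < r" "\<forall>y\<in>cball x r. P y"
proof -
  obtain d where "d > 0" "\<And>y. dist y x < d \<Longrightarrow> P y"
    using assms unfolding eventually_nhds_metric by blast
  then show thesis
    by (intro that[of "d / 2"]) (auto simp: dist_commute)
qed

lemma eventually_nhds_continuous_less:
  fixes f :: "'a::t2_space \<Rightarrow> real"
  assumes "open S" "x \<in> S" "continuous_on S f"
  shows "f x < c \<Longrightarrow> \<forall>\<^sub>F y in nhds x. f y < c" "c < f x \<Longrightarrow> \<forall>\<^sub>F y in nhds x. c < f y"
proof -
  have "filterlim f (nhds (f x)) (nhds x)"
    using assms continuous_on_eq_continuous_at[of S f] by (simp add: continuous_at tendsto_nhds_iff)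
  then show "f x < c \<Longrightarrow> \<forall>\<^sub>F y in nhds x. f y < c" "c < f x \<Longrightarrow> \<forall>\<^sub>F y in nhds x. c < f y"
    by (auto dest: order_tendstoD)
qed

lemma subsolution_Sup:
  fixes U :: "real^'n \<Rightarrow> real"
  assumes \<Omega>: "open \<Omega>" and U: "continuous_on \<Omega> U"
    and A: "\<And>u. u \<in> A \<Longrightarrow> viscosity_subsolution \<Omega> u" "\<And>u. u \<in> A \<Longrightarrow> continuous_on \<Omega> u"
    and le: "\<And>u x. u \<in> A \<Longrightarrow> x \<in> \<Omega> \<Longrightarrow> u x \<le> U x"
    and ge: "\<And>x \<eta>. x \<in> \<Omega> \<Longrightarrow> 0 < \<eta> \<Longrightarrow> \<exists>u\<in>A. U x - \<eta> < u x"
  shows "viscosity_subsolution \<Omega> U"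
  unfolding viscosity_subsolution_def
proof (intro conjI ballI allI impI)
  show "usc_on \<Omega> U"
    using U by (rule continuous_on_imp_semicontinuous)
next
  fix x \<phi> assume x: "x \<in> \<Omega>" and C: "Ck_on 2 \<Omega> \<phi>" and "strict_local_max_at \<Omega> (\<lambda>x. U x - \<phi> x) x"
  then have strict: "\<forall>\<^sub>F z in nhds x. z \<noteq> x \<longrightarrow> U z - \<phi> z < U x - \<phi> x"
    by (simp add: strict_local_max_at_def at_within_open[OF x \<Omega>] eventually_at_filter)
  have c\<phi>: "continuous_on \<Omega> \<phi>"
    using C2_onD(1)[OF Ck_on_imp_C2_on[OF \<Omega> C]] has_derivative_continuous
    by (blast intro: continuous_at_imp_continuous_on)
  \<comment> \<open>\<open>P\<close> stands for any property holding near \<open>x\<close>. It is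
    instantiated below with the strict reverse inequalities for \<open>\<phi>\<close>, which persist
    nearby by continuity and so give contradictions.\<close>
  have approx: "\<exists>y. P y \<and> 0 \<le> inf_laplacian \<phi> y \<and> (0 < U x \<longrightarrow> 1 \<le> norm (grad \<phi> y))"
    if P: "\<forall>\<^sub>F y in nhds x. P y" for P
  proof -
    \<comment> \<open>For positive \<open>U x\<close> two losses are incurred at the touching point,
      one from \<open>u\<close> against \<open>U\<close> and one from \<open>\<phi>\<close>; two
      quarters leave \<open>u y\<close> above \<open>U x / 2\<close>.\<close>
    define \<mu> where "\<mu> = (if 0 < U x then U x / 4 else 1)"
    have \<mu>: "\<mu> > 0" by (simp add: \<mu>_def)
    have "\<forall>\<^sub>F y in nhds x. \<phi> x - \<mu> < \<phi> y"
      using eventually_nhds_continuous_less(2)[OF \<Omega> x c\<phi>] \<mu> by simp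
    with strict P eventually_nhds_in_open[OF \<Omega> x]
    have "\<forall>\<^sub>F y in nhds x. (y \<noteq> x \<longrightarrow> U y - \<phi> y < U x - \<phi> x) \<and> P y \<and> y \<in> \<Omega> \<and> \<phi> x - \<mu> < \<phi> y"
      by eventually_elim simp
    then obtain r where r: "r > 0" and
      "\<forall>y\<in>cball x r. (y \<noteq> x \<longrightarrow> U y - \<phi> y < U x - \<phi> x) \<and> P y \<and> y \<in> \<Omega> \<and> \<phi> x - \<mu> < \<phi> y"
      by (rule eventually_nhds_cball)
    then have R: "\<And>y. y \<in> cball x r \<Longrightarrow> y \<noteq> x \<Longrightarrow> U y - \<phi> y < U x - \<phi> x" "\<And>y. y \<in> cball x r \<Longrightarrow> P y"
      "cball x r \<subseteq> \<Omega>" "\<And>y. y \<in> cball x r \<Longrightarrow> \<phi> x - \<mu> < \<phi> y"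
      by blast+
    have "continuous_on (sphere x r) (\<lambda>y. U y - \<phi> y)"
      using R(3) by (intro continuous_intros continuous_on_subset[OF U] continuous_on_subset[OF c\<phi>]) auto
    moreover have "sphere x r \<noteq> {}" using r by simp
    ultimately obtain s where s: "s \<in> sphere x r" "\<And>y. y \<in> sphere x r \<Longrightarrow> U y - \<phi> y \<le> U s - \<phi> s"
      using continuous_attains_sup[OF compact_sphere] by blast
    have s_less: "U s - \<phi> s < U x - \<phi> x"
      using R(1)[of s] s(1) r by auto
    \<comment> \<open>The second entry is the amount by which \<open>U - \<phi>\<close> drops from
      \<open>x\<close> to the sphere; a member of \<open>A\<close> this close to \<open>U\<close> at
      \<open>x\<close> cannot have its maximum against \<open>\<phi>\<close> on the sphere.\<close>
    define \<eta> where "\<eta> = min \<mu> (U x - \<phi> x - (U s - \<phi> s))"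
    have "\<eta> > 0" using \<mu> s_less by (simp add: \<eta>_def)
    then obtain u where u: "u \<in> A" "U x - \<eta> < u x"
      using ge[OF x] by blast
    have "continuous_on (cball x r) (\<lambda>y. u y - \<phi> y)"
      using R(3) A(2)[OF u(1)] c\<phi> by (intro continuous_intros) (auto intro: continuous_on_subset)
    then obtain y where y: "y \<in> cball x r" "\<And>z. z \<in> cball x r \<Longrightarrow> u z - \<phi> z \<le> u y - \<phi> y"
      using continuous_attains_sup[OF compact_cball, of x r] r by force
    have ux: "u x - \<phi> x \<le> u y - \<phi> y" using y(2) r by simp
    have "y \<in> ball x r"
    proof (rule ccontr)
      assume "y \<notin> ball x r"
      then have "U y - \<phi> y \<le> U s - \<phi> s" using y(1) s(2) by simp
      moreover have "u y \<le> U y" using le[OF u(1)] y(1) R(3) by blast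
      ultimately show False
        using ux u(2) by (simp add: \<eta>_def min_def split: if_splits)
    qed
    then have "\<forall>\<^sub>F z in nhds y. u z - \<phi> z \<le> u y - \<phi> y"
      using eventually_nhds_in_open[OF open_ball] y(2) by (fastforce elim: eventually_mono)
    then have *: "0 \<le> inf_laplacian \<phi> y" "0 < u y \<Longrightarrow> 1 \<le> norm (grad \<phi> y)"
      using A(1)[OF u(1)] C y(1) R(3) unfolding viscosity_subsolution_iff[OF \<Omega>] by blast+
    have "0 < u y" if "0 < U x"
      using ux u(2) R(4)[OF y(1)] that by (simp add: \<eta>_def \<mu>_def)
    with * y(1) R(2) show ?thesis by blast
  qed
  have "0 \<le> inf_laplacian \<phi> x"
  proof (rule ccontr)
    assume "\<not> 0 \<le> inf_laplacian \<phi> x"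
    then have "\<forall>\<^sub>F y in nhds x. inf_laplacian \<phi> y < 0"
      using eventually_nhds_continuous_less(1)[OF \<Omega> x inf_laplacian_continuous_on(2)[OF \<Omega> C]] by simp
    from approx[OF this] show False by auto
  qed
  moreover have "1 \<le> norm (grad \<phi> x)" if "0 < U x"
  proof (rule ccontr)
    assume "\<not> 1 \<le> norm (grad \<phi> x)"
    moreover have "continuous_on \<Omega> (\<lambda>y. norm (grad \<phi> y))"
      by (intro continuous_intros grad_continuous_on \<Omega> C)
    ultimately have "\<forall>\<^sub>F y in nhds x. norm (grad \<phi> y) < 1"
      using eventually_nhds_continuous_less(1)[OF \<Omega> x] by simp
    from approx[OF this] that show False by auto
  qed
  ultimately show "max (- inf_laplacian \<phi> x) (indicator {x\<in>\<Omega>. U x > 0} x - norm (grad \<phi> x)) \<le> 0"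
    using x by (auto simp: indicator_def)
qed

text \<open>The hypotheses \<open>pos\<close> and \<open>bad\<close> express that the supersolution
  condition fails. Then \<open>\<phi>\<close> plus a constant is itself a subsolution near
  \<open>x\<close>, and the maximum of it and \<open>U\<close> on a small ball is a strictly larger
  one. If \<open>U x < 0\<close>, the gradient may be small and the raised piece has to stay
  negative instead.\<close>

lemma subsolution_lift:
  fixes U :: "real^'n \<Rightarrow> real"
  assumes \<Omega>: "open \<Omega>" and U: "continuous_on (closure \<Omega>) U" "viscosity_subsolution \<Omega> U"
    and x: "x \<in> \<Omega>" and C: "Ck_on 2 \<Omega> \<phi>" and strict: "strict_local_min_at \<Omega> (\<lambda>x. U x - \<phi> x) x"
    and pos: "0 < inf_laplacian \<phi> x" and bad: "U x < 0 \<or> 1 < norm (grad \<phi> x)"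
  obtains w where "continuous_on (closure \<Omega>) w" "viscosity_subsolution \<Omega> w"
    "\<forall>y. U y \<le> w y" "\<forall>y. y \<notin> \<Omega> \<longrightarrow> w y = U y" "U x < w x"
proof -
  have c\<phi>: "continuous_on \<Omega> \<phi>"
    using C2_onD(1)[OF Ck_on_imp_C2_on[OF \<Omega> C]] has_derivative_continuous
    by (blast intro: continuous_at_imp_continuous_on)
  have U\<Omega>: "continuous_on \<Omega> U"
    using U(1) closure_subset by (rule continuous_on_subset)
  have "\<forall>\<^sub>F z in nhds x. z \<noteq> x \<longrightarrow> U x - \<phi> x < U z - \<phi> z"
    using strict by (simp add: strict_local_min_at_def at_within_open[OF x \<Omega>] eventually_at_filter)
  moreover have "\<forall>\<^sub>F z in nhds x. 0 < inf_laplacian \<phi> z"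
    using eventually_nhds_continuous_less(2)[OF \<Omega> x inf_laplacian_continuous_on(2)[OF \<Omega> C]] pos by simp
  moreover have "\<forall>\<^sub>F z in nhds x. U x < 0 \<and> \<phi> z < \<phi> x - U x / 4 \<or> 1 < norm (grad \<phi> z)"
    using bad
  proof
    assume "U x < 0"
    moreover from this have "\<forall>\<^sub>F z in nhds x. \<phi> z < \<phi> x - U x / 4"
      using eventually_nhds_continuous_less(1)[OF \<Omega> x c\<phi>] by simp
    ultimately show ?thesis by (auto elim: eventually_mono)
  next
    assume "1 < norm (grad \<phi> x)"
    moreover have "continuous_on \<Omega> (\<lambda>y. norm (grad \<phi> y))"
      by (intro continuous_intros grad_continuous_on \<Omega> C)
    ultimately have "\<forall>\<^sub>F y in nhds x. 1 < norm (grad \<phi> y)"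
      using eventually_nhds_continuous_less(2)[OF \<Omega> x] by simp
    then show ?thesis by (auto elim: eventually_mono)
  qed
  moreover note eventually_nhds_in_open[OF \<Omega> x]
  ultimately have "\<forall>\<^sub>F z in nhds x. (z \<noteq> x \<longrightarrow> U x - \<phi> x < U z - \<phi> z) \<and> 0 < inf_laplacian \<phi> z \<and>
      (U x < 0 \<and> \<phi> z < \<phi> x - U x / 4 \<or> 1 < norm (grad \<phi> z)) \<and> z \<in> \<Omega>"
    by eventually_elim simp
  then obtain r where r: "r > 0" and "\<forall>z\<in>cball x r.
      (z \<noteq> x \<longrightarrow> U x - \<phi> x < U z - \<phi> z) \<and> 0 < inf_laplacian \<phi> z \<and>
      (U x < 0 \<and> \<phi> z < \<phi> x - U x / 4 \<or> 1 < norm (grad \<phi> z)) \<and> z \<in> \<Omega>"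
    by (rule eventually_nhds_cball)
  then have R: "\<And>z. z \<in> cball x r \<Longrightarrow> z \<noteq> x \<Longrightarrow> U x - \<phi> x < U z - \<phi> z"
    "\<And>z. z \<in> cball x r \<Longrightarrow> 0 < inf_laplacian \<phi> z"
    "\<And>z. z \<in> cball x r \<Longrightarrow> U x < 0 \<and> \<phi> z < \<phi> x - U x / 4 \<or> 1 < norm (grad \<phi> z)"
    "cball x r \<subseteq> \<Omega>"
    by blast+
  have "continuous_on (sphere x r) (\<lambda>y. U y - \<phi> y)"
    using R(4) by (intro continuous_intros continuous_on_subset[OF U\<Omega>] continuous_on_subset[OF c\<phi>]) auto
  moreover have "sphere x r \<noteq> {}" using r by simp
  ultimately obtain s where s: "s \<in> sphere x r" "\<And>y. y \<in> sphere x r \<Longrightarrow> U s - \<phi> s \<le> U y - \<phi> y"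
    using continuous_attains_inf[OF compact_sphere] by blast
  have s_less: "U x - \<phi> x < U s - \<phi> s"
    using R(1)[of s] s(1) r by auto
  \<comment> \<open>Below the gap on the sphere, so that \<open>\<phi> + c < U\<close> there and the
    pieces glue continuously. For \<open>U x < 0\<close>, one quarter is spent on the variation of
    \<open>\<phi>\<close> and one on \<open>\<kappa>\<close>, so \<open>\<phi> + c\<close> remains
    below \<open>U x / 2\<close> wherever no gradient bound is available.\<close>
  define \<kappa> where "\<kappa> = min ((U s - \<phi> s - (U x - \<phi> x)) / 2) (if U x < 0 then - U x / 4 else 1)"
  have \<kappa>: "0 < \<kappa>" "\<kappa> < U s - \<phi> s - (U x - \<phi> x)" "U x < 0 \<Longrightarrow> \<kappa> \<le> - U x / 4"
    using s_less by (auto simp: \<kappa>_def min_def)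
  define c where "c = U x - \<phi> x + \<kappa>"
  define w where "w = (\<lambda>z. if z \<in> cball x r then max (U z) (\<phi> z + c) else U z)"
  have sph: "\<phi> z + c < U z" if "z \<in> sphere x r" for z
    using s(2)[OF that] \<kappa>(2) by (simp add: c_def)
  have "continuous_on (cball x r \<union> (closure \<Omega> - ball x r)) w"
    unfolding w_def
  proof (rule continuous_on_cases)
    show "continuous_on (cball x r) (\<lambda>z. max (U z) (\<phi> z + c))"
      by (intro continuous_intros continuous_on_subset[OF U\<Omega> R(4)] continuous_on_subset[OF c\<phi> R(4)])
    show "continuous_on (closure \<Omega> - ball x r) U"
      using U(1) by (rule continuous_on_subset) auto
    show "\<forall>z. z \<in> cball x r \<and> z \<notin> cball x r \<or> z \<in> closure \<Omega> - ball x r \<and> z \<in> cball x r \<longrightarrow>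
        max (U z) (\<phi> z + c) = U z"
      using sph by (force simp: max_def)
  qed (auto intro: closed_Diff)
  moreover have "cball x r \<union> (closure \<Omega> - ball x r) = closure \<Omega>"
    using R(4) closure_subset[of \<Omega>] ball_subset_cball by blast
  ultimately have cw: "continuous_on (closure \<Omega>) w" by simp
  have Uw: "U y \<le> w y" for y by (simp add: w_def)
  have sub: "viscosity_subsolution \<Omega> w"
    unfolding viscosity_subsolution_iff[OF \<Omega>]
  proof (intro conjI ballI allI impI)
    show "usc_on \<Omega> w"
      using cw closure_subset by (intro continuous_on_imp_semicontinuous) (rule continuous_on_subset)
  next
    fix y \<theta> assume y: "y \<in> \<Omega>" and \<theta>: "Ck_on 2 \<Omega> \<theta>" and m: "\<forall>\<^sub>F z in nhds y. w z - \<theta> z \<le> w y - \<theta> y"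
    have "0 \<le> inf_laplacian \<theta> y \<and> (0 < w y \<longrightarrow> 1 \<le> norm (grad \<theta> y))"
    proof (cases "w y = U y")
      case True
      have "\<forall>\<^sub>F z in nhds y. U z - \<theta> z \<le> U y - \<theta> y"
        using m by (rule eventually_mono) (use Uw True in \<open>smt (verit)\<close>)
      then show ?thesis
        using U(2) y \<theta> True unfolding viscosity_subsolution_iff[OF \<Omega>] by force
    next
      case False
      then have yc: "y \<in> cball x r" and wy: "w y = \<phi> y + c"
        by (auto simp: w_def max_def split: if_splits)
      have "y \<in> ball x r"
        using sph[of y] yc False by (force simp: w_def max_def)
      have "\<forall>\<^sub>F z in nhds y. \<theta> y - \<phi> y \<le> \<theta> z - \<phi> z"
        using m eventually_nhds_in_open[OF open_ball \<open>y \<in> ball x r\<close>]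
      proof eventually_elim
        case (elim z)
        then have "\<phi> z + c \<le> w z" by (simp add: w_def)
        with elim(1) wy show ?case by simp
      qed
      note t = touching_compare[OF \<Omega> y \<theta> C this]
      have "1 < norm (grad \<phi> y)" if "0 < w y"
        using R(3)[OF yc] that \<kappa>(3) unfolding wy c_def by auto
      then show ?thesis
        using t R(2)[OF yc] by auto
    qed
    then show "0 \<le> inf_laplacian \<theta> y" "0 < w y \<Longrightarrow> 1 \<le> norm (grad \<theta> y)" by auto
  qed
  show thesis
  proof (rule that[OF cw sub])
    show "\<forall>y. U y \<le> w y" "\<forall>y. y \<notin> \<Omega> \<longrightarrow> w y = U y"
      using Uw R(4) by (auto simp: w_def)
    show "U x < w x"
      using r \<kappa>(1) by (simp add: w_def c_def)
  qed
qed

lemma continuous_on_if_pointwise_lipschitz: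
  fixes f :: "'a::metric_space \<Rightarrow> real"
  assumes "\<And>y. y \<in> S \<Longrightarrow> \<exists>r>0. \<exists>\<Lambda>. \<forall>a\<in>S. dist a y \<le> r \<longrightarrow> \<bar>f a - f y\<bar> \<le> \<Lambda> * dist a y"
  shows "continuous_on S f"
  unfolding continuous_on_def
proof
  fix y assume "y \<in> S"
  then obtain r \<Lambda> where r: "r > 0" "\<And>a. a \<in> S \<Longrightarrow> dist a y \<le> r \<Longrightarrow> \<bar>f a - f y\<bar> \<le> \<Lambda> * dist a y"
    using assms by blast
  have "((\<lambda>a. \<Lambda> * dist a y) \<longlongrightarrow> \<Lambda> * dist y y) (at y within S)"
    by (intro tendsto_intros)
  then have "((\<lambda>a. \<Lambda> * dist a y) \<longlongrightarrow> 0) (at y within S)" by simp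
  moreover have "\<forall>\<^sub>F a in at y within S. norm (f a - f y) \<le> \<Lambda> * dist a y"
    unfolding eventually_at using r by (auto intro!: exI[of _ r])
  ultimately have "((\<lambda>a. f a - f y) \<longlongrightarrow> 0) (at y within S)"
    by (rule Lim_null_comparison[rotated])
  then show "(f \<longlongrightarrow> f y) (at y within S)"
    by (simp add: LIM_zero_iff)
qed

theorem perron:
  fixes g :: "real^'n \<Rightarrow> real"
  assumes \<Omega>: "open \<Omega>" "bounded \<Omega>" "\<Omega> \<noteq> {}" and g: "L-lipschitz_on (frontier \<Omega>) g" and L: "1 \<le> L"
  shows "\<exists>u. dirichlet_solution \<Omega> g u"
proof -
  have glip: "g x \<le> g z + L * norm (x - z)" if "x \<in> frontier \<Omega>" "z \<in> frontier \<Omega>" for x z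
    using lipschitz_onD[OF g that] by (auto simp: dist_real_def dist_norm)
  have K: "compact (closure \<Omega>)" using \<Omega>(2) by simp
  have fr: "frontier \<Omega> \<subseteq> closure \<Omega>" "frontier \<Omega> \<inter> \<Omega> = {}" "closure \<Omega> = \<Omega> \<union> frontier \<Omega>"
    using \<Omega>(1) closure_subset by (auto simp: frontier_def interior_open)
  have "compact (frontier \<Omega>)" using \<Omega>(2) by (rule compact_frontier_bounded)
  then have "bounded (g ` frontier \<Omega>)"
    using lipschitz_on_continuous_on[OF g] compact_continuous_image compact_imp_bounded by blast
  then obtain B where B: "\<And>z. z \<in> frontier \<Omega> \<Longrightarrow> \<bar>g z\<bar> \<le> B"
    unfolding bounded_iff by auto
  obtain z0 where z0: "z0 \<in> frontier \<Omega>"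
    using frontier_not_empty[of \<Omega>] \<Omega>(2,3) by force
  define D where "D = diameter (closure \<Omega>)"
  have D: "norm (x - y) \<le> D" if "x \<in> closure \<Omega>" "y \<in> closure \<Omega>" for x y
    unfolding D_def using diameter_bounded_bound[OF compact_imp_bounded[OF K] that] by (simp add: dist_norm)
  \<comment> \<open>Bounds every barrier \<open>g z \<plusminus> L * norm (x - z)\<close> in
    absolute value on the closure.\<close>
  define C where "C = B + L * D"
  have LD: "L * norm (x - z) \<le> L * D" if "x \<in> closure \<Omega>" "z \<in> frontier \<Omega>" for x z
    using D[of x z] that fr(1) L by auto
  \<comment> \<open>The lower bound belongs to the class because it makes the local Lipschitz
    constants uniform over its members; the matching upper bound \<open>uC\<close> follows from the
    upward cones.\<close>
  define A where "A = {u. continuous_on (closure \<Omega>) u \<and> viscosity_subsolution \<Omega> u \<and>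
    (\<forall>z\<in>frontier \<Omega>. u z \<le> g z) \<and> (\<forall>x\<in>closure \<Omega>. - C \<le> u x)}"
  have A: "continuous_on (closure \<Omega>) u" "viscosity_subsolution \<Omega> u" "\<And>z. z \<in> frontier \<Omega> \<Longrightarrow> u z \<le> g z"
    "\<And>x. x \<in> closure \<Omega> \<Longrightarrow> - C \<le> u x" "continuous_on \<Omega> u" if "u \<in> A" for u
    using that continuous_on_subset[OF _ closure_subset, of \<Omega> u] by (auto simp: A_def)
  have upper: "u x \<le> g z + L * norm (x - z)" if u: "u \<in> A" and x: "x \<in> closure \<Omega>" and z: "z \<in> frontier \<Omega>"
    for u x z
  proof -
    have bd: "u y \<le> g z + L * norm (y - z)" if "y \<in> frontier \<Omega>" for y
      using A(3)[OF u that] glip[OF that z] by simp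
    moreover have "u x \<le> g z + L * norm (x - z)" if "x \<in> \<Omega>"
      using L fr(2) z by (intro subsolution_below_cone[OF \<Omega>(1) A(2)[OF u] _ \<Omega>(1,2) _ A(1)[OF u] _ bd that]) auto
    ultimately show ?thesis using x fr(3) by blast
  qed
  have cone: "(\<lambda>x. g z - L * norm (x - z)) \<in> A" if z: "z \<in> frontier \<Omega>" for z
  proof -
    have "g z - L * norm (y - z) \<le> g y" if "y \<in> frontier \<Omega>" for y
      using glip[OF z that] by (simp add: norm_minus_commute)
    moreover have "- C \<le> g z - L * norm (x - z)" if "x \<in> closure \<Omega>" for x
      using LD[OF that z] B[OF z] by (simp add: C_def)
    moreover have "viscosity_subsolution \<Omega> (\<lambda>x. g z - L * norm (x - z))"
      using fr(2) z L \<Omega>(1) by (intro subsolution_cone) auto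
    ultimately show ?thesis
      by (auto simp: A_def intro!: continuous_intros)
  qed
  have uC: "u x \<le> C" if "u \<in> A" "x \<in> closure \<Omega>" for u x
    using upper[OF that z0] LD[OF that(2) z0] B[OF z0] by (simp add: C_def)
  define U where "U = (\<lambda>x. SUP u\<in>A. u x)"
  have ne: "A \<noteq> {}" using cone[OF z0] by blast
  have bdd: "bdd_above ((\<lambda>u. u x) ` A)" if "x \<in> closure \<Omega>" for x
    using uC that by (auto intro!: bdd_aboveI)
  have leU: "u x \<le> U x" if "u \<in> A" "x \<in> closure \<Omega>" for u x
    unfolding U_def by (rule cSUP_upper[OF that(1) bdd[OF that(2)]])
  have Ule: "U x \<le> c" if "\<And>u. u \<in> A \<Longrightarrow> u x \<le> c" for x c
    unfolding U_def by (rule cSUP_least[OF ne that])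
  have U_upper: "U x \<le> g z + L * norm (x - z)" and U_lower: "g z - L * norm (x - z) \<le> U x"
    if "x \<in> closure \<Omega>" "z \<in> frontier \<Omega>" for x z
    using upper leU[OF cone] that by (auto intro: Ule)
  have Ug: "U z = g z" if "z \<in> frontier \<Omega>" for z
    using U_upper[of z z] U_lower[of z z] that fr(1) by auto
  \<comment> \<open>The cone about \<open>y\<close> that reaches the common upper bound
    \<open>C\<close> at distance \<open>r\<close> has slope \<open>(C - u y) / r\<close>, and the
    common lower bound turns this into a constant independent of \<open>u\<close>.\<close>
  have equi: "u a \<le> u y + 2 * C / r * norm (a - y)"
    if u: "u \<in> A" and r: "r > 0" "cball y r \<subseteq> \<Omega>" and a: "a \<in> cball y r" for u a y r
  proof -
    have cl: "cball y r \<subseteq> closure \<Omega>" using r(2) closure_subset by blast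
    have "y \<in> closure \<Omega>" using cl r(1) by (simp add: subset_iff)
    then have "- C \<le> u y" by (rule A(4)[OF u])
    have "u a \<le> u y + (C - u y) / r * norm (a - y)"
      using uC[OF u] cl by (intro subsolution_ball[OF \<Omega>(1) A(2,5)[OF u] r _ a]) auto
    also have "\<dots> \<le> u y + 2 * C / r * norm (a - y)"
      using \<open>- C \<le> u y\<close> r(1) by (intro add_left_mono mult_right_mono divide_right_mono) auto
    finally show ?thesis .
  qed
  have equiU: "U a \<le> U y + 2 * C / r * norm (a - y)"
    if r: "r > 0" "cball y r \<subseteq> \<Omega>" and a: "a \<in> cball y r" for a y r
  proof (rule Ule)
    fix u assume u: "u \<in> A"
    have "y \<in> closure \<Omega>" using r closure_subset[of \<Omega>] by force
    then show "u a \<le> U y + 2 * C / r * norm (a - y)"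
      using equi[OF u r a] leU[OF u] by fastforce
  qed
  have cU: "continuous_on (closure \<Omega>) U"
  proof (rule continuous_on_if_pointwise_lipschitz)
    fix y assume "y \<in> closure \<Omega>"
    then consider "y \<in> frontier \<Omega>" | "y \<in> \<Omega>" using fr(3) by blast
    then show "\<exists>r>0. \<exists>\<Lambda>. \<forall>a\<in>closure \<Omega>. dist a y \<le> r \<longrightarrow> \<bar>U a - U y\<bar> \<le> \<Lambda> * dist a y"
    proof cases
      case 1
      have "\<bar>U a - U y\<bar> \<le> L * dist a y" if "a \<in> closure \<Omega>" for a
        using U_upper[OF that 1] U_lower[OF that 1] Ug[OF 1] by (simp add: dist_norm abs_le_iff)
      then show ?thesis by (intro exI[of _ 1] conjI exI[of _ L]) auto
    next
      case 2
      then obtain r where r: "r > 0" "cball y r \<subseteq> \<Omega>"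
        using \<Omega>(1) open_contains_cball by blast
      \<comment> \<open>\<open>equiU\<close> is one-sided, so it is applied with centre
        \<open>y\<close> and with centre \<open>a\<close>; halving the radius keeps the ball about
        \<open>a\<close> inside \<open>\<Omega>\<close>.\<close>
      have "\<bar>U a - U y\<bar> \<le> 2 * C / (r / 2) * dist a y" if a: "dist a y \<le> r / 2" for a
      proof -
        have "cball a (r / 2) \<subseteq> cball y r" "cball y (r / 2) \<subseteq> cball y r"
          using a r(1) by (auto simp: cball_subset_cball_iff)
        then have "cball a (r / 2) \<subseteq> \<Omega>" "cball y (r / 2) \<subseteq> \<Omega>" using r(2) by auto
        then show ?thesis
          using equiU[of "r / 2" y a] equiU[of "r / 2" a y] r(1) a
          by (auto simp: dist_norm norm_minus_commute abs_le_iff)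
      qed
      then show ?thesis using r(1) by (intro exI[of _ "r / 2"] conjI exI[of _ "2 * C / (r / 2)"]) auto
    qed
  qed
  then have cU\<Omega>: "continuous_on \<Omega> U"
    using closure_subset by (rule continuous_on_subset)
  have subU: "viscosity_subsolution \<Omega> U"
  proof (rule subsolution_Sup[OF \<Omega>(1) cU\<Omega>])
    show "u x \<le> U x" if "u \<in> A" "x \<in> \<Omega>" for u x
      using leU that closure_subset by blast
    show "\<exists>u\<in>A. U x - \<eta> < u x" if "x \<in> \<Omega>" "0 < \<eta>" for x \<eta>
      using Ule[of x "U x - \<eta>"] that(2) by force
  qed (use A in auto)
  have superU: "viscosity_supersolution \<Omega> U"
    unfolding viscosity_supersolution_def
  proof (intro conjI ballI allI impI)
    show "lsc_on \<Omega> U"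
      using cU\<Omega> by (rule continuous_on_imp_semicontinuous)
  next
    fix x \<phi> assume x: "x \<in> \<Omega>" and C2: "Ck_on 2 \<Omega> \<phi>" and m: "strict_local_min_at \<Omega> (\<lambda>x. U x - \<phi> x) x"
    have "inf_laplacian \<phi> x \<le> 0 \<or> 0 \<le> U x \<and> norm (grad \<phi> x) \<le> 1"
    proof (rule ccontr)
      assume n: "\<not> ?thesis"
      have "0 < inf_laplacian \<phi> x" "U x < 0 \<or> 1 < norm (grad \<phi> x)"
        using n by auto
      then obtain w where w: "continuous_on (closure \<Omega>) w" "viscosity_subsolution \<Omega> w"
        "\<forall>y. U y \<le> w y" "\<forall>y. y \<notin> \<Omega> \<longrightarrow> w y = U y" "U x < w x"
        by (rule subsolution_lift[OF \<Omega>(1) cU subU x C2 m])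
      have "w z \<le> g z" if "z \<in> frontier \<Omega>" for z
        using w(4) Ug[OF that] that fr(2) by auto
      moreover have "- C \<le> w y" if "y \<in> closure \<Omega>" for y
        using A(4)[OF cone[OF z0] that] leU[OF cone[OF z0] that] w(3) by (meson order_trans)
      ultimately have "w \<in> A"
        using w(1,2) by (auto simp: A_def)
      then have "w x \<le> U x"
        using leU x closure_subset by blast
      with w(5) show False by simp
    qed
    then show "max (- inf_laplacian \<phi> x) (indicator {x\<in>\<Omega>. U x \<ge> 0} x - norm (grad \<phi> x)) \<ge> 0"
      using x by (auto simp: indicator_def le_max_iff_disj)
  qed
  have "dirichlet_solution \<Omega> g U"
    unfolding dirichlet_solution_def viscosity_solution_def
    using cU cU\<Omega> subU superU Ug by blast
  then show ?thesis by blast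
qed

lemma dirichlet_comparison:
  assumes \<Omega>: "open \<Omega>" "bounded \<Omega>"
    and "dirichlet_solution \<Omega> g1 u1" "dirichlet_solution \<Omega> g2 u2"
    and "\<And>x. x \<in> frontier \<Omega> \<Longrightarrow> g1 x \<le> g2 x" and "x \<in> closure \<Omega>"
  shows "u1 x \<le> u2 x"
proof (cases "x \<in> \<Omega>")
  case True
  show ?thesis
    by (rule comparison[OF \<Omega> _ _ _ _ _ True])
      (use assms in \<open>auto simp: dirichlet_solution_def viscosity_solution_def\<close>)
next
  case False
  then have "x \<in> frontier \<Omega>"
    using assms(6) \<Omega>(1) by (simp add: frontier_def interior_open)
  then show ?thesis
    using assms by (simp add: dirichlet_solution_def)
qed

theorem theorem1p3:
  fixes \<Omega> :: "(real^'n) set"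
  assumes "bounded \<Omega>" and "regular_domain \<Omega>"
  shows "(\<forall>g :: real^'n \<Rightarrow> real. (\<exists>L. L-lipschitz_on (frontier \<Omega>) g) \<longrightarrow>
            (\<exists>u. dirichlet_solution \<Omega> g u \<and>
                 (\<forall>v. dirichlet_solution \<Omega> g v \<longrightarrow> (\<forall>x\<in>closure \<Omega>. v x = u x)))) \<and>
         (\<forall>(g1 :: real^'n \<Rightarrow> real) (g2 :: real^'n \<Rightarrow> real) u1 u2.
            (\<exists>L. L-lipschitz_on (frontier \<Omega>) g1) \<longrightarrow> (\<exists>L. L-lipschitz_on (frontier \<Omega>) g2) \<longrightarrow>
            (\<forall>x\<in>frontier \<Omega>. g1 x \<le> g2 x) \<longrightarrow>
            dirichlet_solution \<Omega> g1 u1 \<longrightarrow> dirichlet_solution \<Omega> g2 u2 \<longrightarrow>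
            (\<forall>x\<in>\<Omega>. u1 x \<le> u2 x))"
proof -
  have \<Omega>: "open \<Omega>" "\<Omega> \<noteq> {}"
    using assms(2) by (auto simp: regular_domain_def)
  note cmp = dirichlet_comparison[OF \<Omega>(1) assms(1)]
  have "\<exists>u. dirichlet_solution \<Omega> g u \<and> (\<forall>v. dirichlet_solution \<Omega> g v \<longrightarrow> (\<forall>x\<in>closure \<Omega>. v x = u x))"
    if "L-lipschitz_on (frontier \<Omega>) g" for g L
  proof -
    \<comment> \<open>The barrier cones must have slope at least 1 to be subsolutions, so the
      Lipschitz constant is enlarged.\<close>
    have "(max 1 L)-lipschitz_on (frontier \<Omega>) g"
      using that by (rule lipschitz_on_le) simp
    then obtain u where u: "dirichlet_solution \<Omega> g u"
      using perron[OF \<Omega>(1) assms(1) \<Omega>(2)] by fastforce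
    have "v x = u x" if "dirichlet_solution \<Omega> g v" "x \<in> closure \<Omega>" for v x
      using cmp[OF that(1) u _ that(2)] cmp[OF u that(1) _ that(2)] by (simp add: order_antisym)
    with u show ?thesis by blast
  qed
  moreover have "u1 x \<le> u2 x" if "\<forall>x\<in>frontier \<Omega>. g1 x \<le> g2 x"
    "dirichlet_solution \<Omega> g1 u1" "dirichlet_solution \<Omega> g2 u2" "x \<in> \<Omega>" for g1 g2 u1 u2 x
    using cmp[OF that(2,3)] that(1,4) closure_subset by blast
  ultimately show ?thesis by blast
qed

end
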